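(* Let $s,t\ge 1$ be coprime integers. Then $$\frac{\sum_{\lambda\in \mathcal{C}_s\cap \mathcal{C}_t} |\mathrm{Stab}_{G_{s,t}}(\lambda)|^{-1}\cdot |\lambda|}{\sum_{\lambda\in \mathcal{C}_s\cap \mathcal{C}_t} |\mathrm{Stab}_{G_{s,t}}(\lambda)|^{-1}} = \frac{1}{24}(s-1)(t^2-1),$$ where the (finite) sums run over all partitions that are simultaneously $s$-cores and $t$-cores, and the (finite) stabilizers are taken with respect to the action of the group $G_{s,t}$ on $\mathcal{C}_s$.
   Context: A partition is an infinite weakly decreasing sequence $\lambda=(\lambda_1,\lambda_2,\ldots)$ of nonnegative integers with finite size $|\lambda|=\lambda_1+\lambda_2+\cdots$. Its Young diagram is $[\lambda]=\{(r,c)\in\mathbb{Z}_{>0}^2 : c\le\lambda_r\}$, its conjugate $\overline{\lambda}$ is given by $\overline{\lambda}_r=\#\{c\in\mathbb{Z}_{>0}: r\le\lambda_c\}$, and the hook length at $(r,c)\in[\lambda]$ is $1+(\lambda_r-r)+(\overline{\lambda}_c-c)$. A partition is an $s$-core if it has no hook of length $s$; $\mathcal{C}_s$ is the set of $s$-cores. For coprime $s,t$, the set $\mathcal{C}_s\cap\mathcal{C}_t$ is finite. Beta-sets and $s$-sets: the beta-set of $\lambda$ is $B^\lambda=\{\lambda_i-i : i\ge1\}\subset\mathbb{Z}$; $\lambda$ is an $s$-core iff $B^\lambda-s\subseteq B^\lambda$. For an $s$-core $\lambda$, its $s$-set is $\mathcal{S}_s(\lambda)=(B^\lambda+s)\setminus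 B^\lambda$. It consists of $s$ integers $a_{s,i}(\lambda)$ ($i\in\mathbb{Z}/s\mathbb{Z}$) with $a_{s,i}(\lambda)\equiv i\pmod s$ and $\sum_i a_{s,i}(\lambda)=\binom{s}{2}$, and $\lambda\mapsto\mathcal{S}_s(\lambda)$ is a bijection from $\mathcal{C}_s$ to the collection of all sets of $s$ integers that are pairwise incongruent modulo $s$ and have sum $\binom{s}{2}$. The group $G_{s,t}$: the group (under composition) of permutations $f:\mathbb{Z}\to\mathbb{Z}$ such that $f(m+s)=f(m)+s$ for all $m$; $\sum_{i=0}^{s-1}f(i)=\binom{s}{2}$; and $f(m)\equiv m\pmod t$ for all $m$. It acts on $\mathcal{C}_s$ by letting $f\lambda$ be the $s$-core with $\mathcal{S}_s(f\lambda)=f(\mathcal{S}_s(\lambda))$ (equivalently $B^{f\lambda}=f(B^\lambda)$). *)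

theory Defs
  imports Complex_Main "HOL-Algebra.Group_Action" "HOL-Number_Theory.Cong"
begin

text \<open>
  Sequences are indexed from 0: \<open>lam i\<close> is the part usually written \<open>\<lambda>\<^sub>i\<^sub>+\<^sub>1\<close>, and the
  pair \<open>(r, c)\<close> stands for the box in row \<open>r + 1\<close> and column \<open>c + 1\<close>. Summability in the
  discrete space of natural numbers says exactly that the size is finite.
\<close>

definition partition :: "(nat \<Rightarrow> nat) \<Rightarrow> bool" where
  "partition lam \<longleftrightarrow> antimono lam \<and> summable lam"

definition psize :: "(nat \<Rightarrow> nat) \<Rightarrow> nat" where
  "psize lam = (\<Sum>i. lam i)"

definition young_diagram :: "(nat \<Rightarrow> nat) \<Rightarrow> (nat \<times> nat) set" where
  "young_diagram lam = {(r, c). c < lam r}"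

definition conjugate :: "(nat \<Rightarrow> nat) \<Rightarrow> nat \<Rightarrow> nat" where
  "conjugate lam r = card {c. r < lam c}"

definition hook_length :: "(nat \<Rightarrow> nat) \<Rightarrow> nat \<Rightarrow> nat \<Rightarrow> int" where
  "hook_length lam r c =
     1 + (int (lam r) - int (r + 1)) + (int (conjugate lam c) - int (c + 1))"

definition cores :: "nat \<Rightarrow> (nat \<Rightarrow> nat) set" where
  "cores s = {lam. partition lam \<and> (\<forall>(r, c) \<in> young_diagram lam. hook_length lam r c \<noteq> int s)}"

definition beta_set :: "(nat \<Rightarrow> nat) \<Rightarrow> int set" where
  "beta_set lam = {int (lam i) - int (i + 1) | i. True}"

definition s_set :: "nat \<Rightarrow> (nat \<Rightarrow> nat) \<Rightarrow> int set" where
  "s_set s lam = (\<lambda>b. b + int s) ` beta_set lam - beta_set lam"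

definition core_group :: "nat \<Rightarrow> nat \<Rightarrow> (int \<Rightarrow> int) monoid" where
  "core_group s t =
     \<lparr>carrier = {f. bij f \<and> (\<forall>m. f (m + int s) = f m + int s)
                   \<and> (\<Sum>i<s. f (int i)) = int (s choose 2)
                   \<and> (\<forall>m. [f m = m] (mod int t))},
      monoid.mult = (\<circ>), one = id\<rparr>"

text \<open>
  The definite description is meaningful because an \<open>s\<close>-core is determined by its
  \<open>s\<close>-set, and every set of \<open>s\<close> integers that are pairwise incongruent modulo \<open>s\<close> and sum
  to \<open>s choose 2\<close> is the \<open>s\<close>-set of an \<open>s\<close>-core. As in the library's group actions, maps are
  extensional on the set acted upon.
\<close>

definition core_action :: "nat \<Rightarrow> (int \<Rightarrow> int) \<Rightarrow> (nat \<Rightarrow> nat) \<Rightarrow> (nat \<Rightarrow> nat)" where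
  "core_action s f =
     (\<lambda>lam\<in>cores s. THE mu. mu \<in> cores s \<and> s_set s mu = f ` s_set s lam)"

abbreviation Stab :: "nat \<Rightarrow> nat \<Rightarrow> (nat \<Rightarrow> nat) \<Rightarrow> (int \<Rightarrow> int) set" where
  "Stab s t lam \<equiv> stabilizer (core_group s t) (core_action s) lam"

end

theory Submission
  imports Defs "HOL-Combinatorics.Permutations"
begin

text \<open>
  An \<open>n\<close>-core is encoded by the function \<open>a\<close> sending each integer to the element of its \<open>n\<close>-set in the
  same class modulo \<open>n\<close>; its beta-set is \<open>{x. x < a x}\<close>, and its size is
  \<open>(\<Sum>x<n. (a x)\<^sup>2 - x\<^sup>2) / (2 n)\<close>.

  The stabilizer of an \<open>s\<close>-core consists of the permutations of its \<open>s\<close>-set that preserve residues modulo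
  \<open>t\<close>, so \<open>s! / |Stab|\<close> counts the words \<open>w\<close> of length \<open>s\<close> over \<open>\<int>/t\<close> whose letters are these residues in
  some order. If \<open>b\<close> encodes the same partition as a \<open>t\<close>-core, then
  \<open>b j - b (j - s) = s - t * #{i. w i = j}\<close>, so the letters determine the core, and every word with
  letter sum \<open>s choose 2\<close> occurs. The weighted average is thus an average over these words.

  Adding a constant to all letters only translates \<open>b\<close>, and changes the letter sum by a multiple
  of \<open>s\<close>, which is invertible modulo \<open>t\<close>; hence the constraint on the sum can be dropped. The letters are
  then independent and uniform, and \<open>b j\<close> is a constant plus a sum of \<open>s\<close> independent terms, each uniform
  on \<open>{0..<t}\<close>, so its second moment is elementary.
\<close>

section \<open>Beta-sets\<close>

definition beta :: "(nat \<Rightarrow> nat) \<Rightarrow> nat \<Rightarrow> int" where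
  "beta lam i = int (lam i) - int (i + 1)"

lemma beta_set_eq_range: "beta_set lam = range (beta lam)"
  by (auto simp: beta_set_def beta_def)

lemma partition_antimono: "partition lam \<Longrightarrow> i \<le> j \<Longrightarrow> lam j \<le> lam i"
  by (auto simp: partition_def antimono_def)

lemma beta_less_iff:
  assumes "partition lam"
  shows "beta lam i < beta lam j \<longleftrightarrow> j < i"
proof -
  have "beta lam i < beta lam j" if "j < i" for i j
    using partition_antimono[OF assms, of j i] that by (simp add: beta_def)
  then show ?thesis
    by (metis not_less_iff_gr_or_eq)
qed

lemma beta_eq_iff:
  assumes "partition lam"
  shows "beta lam i = beta lam j \<longleftrightarrow> i = j"
  using beta_less_iff[OF assms] by (metis nat_neq_iff order_less_irrefl)

lemma partition_iff: "partition lam \<longleftrightarrow> antimono lam \<and> (\<exists>N. \<forall>i\<ge>N. lam i = 0)"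
proof -
  have "\<exists>N. \<forall>i\<ge>N. lam i = 0" if sm: "summable lam"
  proof -
    obtain S where "(\<lambda>n. \<Sum>i<n. lam i) \<longlonglongrightarrow> S"
      using sm unfolding summable_def sums_def by blast
    then obtain N where N: "\<And>n. n \<ge> N \<Longrightarrow> (\<Sum>i<n. lam i) = S"
      by (auto simp: tendsto_discrete eventually_sequentially)
    have "lam i = 0" if "i \<ge> N" for i
      using N[of i] N[of "Suc i"] that by simp
    then show ?thesis by blast
  qed
  moreover have "summable lam" if "\<forall>i\<ge>N. lam i = 0" for N
    using that by (intro summable_finite[of "{..<N}"]) auto
  ultimately show ?thesis
    by (auto simp: partition_def)
qed

lemma psize_eq_sum: "\<forall>i\<ge>N. lam i = 0 \<Longrightarrow> psize lam = (\<Sum>i<N. lam i)"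
  unfolding psize_def by (rule suminf_finite) auto

text \<open>The zero parts from index \<open>N\<close> on contribute exactly the integers below
  \<open>- int N\<close>, so everything about the infinite beta-set can be read off a finite
  window.\<close>

lemma beta_set_truncate:
  assumes "\<forall>i\<ge>N. lam i = 0"
  shows "beta_set lam \<inter> {- int N..} = beta lam ` {..<N}"
    and "x < - int N \<Longrightarrow> x \<in> beta_set lam"
proof -
  have "beta lam i \<ge> - int N \<longleftrightarrow> i < N" for i
    using assms by (cases "i < N") (auto simp: beta_def)
  then show "beta_set lam \<inter> {- int N..} = beta lam ` {..<N}"
    by (auto simp: beta_set_eq_range)
next
  assume x: "x < - int N"
  then have "x = beta lam (nat (- x - 1))"
    using assms by (auto simp: beta_def)
  then show "x \<in> beta_set lam"
    by (auto simp: beta_set_eq_range)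
qed

lemma psize_eq_sum_beta_set:
  assumes "partition lam" "\<forall>i\<ge>N. lam i = 0"
  shows "2 * int (psize lam) = 2 * (\<Sum>x\<in>beta_set lam \<inter> {- int N..}. x) + int N * (int N + 1)"
proof -
  have "(\<Sum>x\<in>beta_set lam \<inter> {- int N..}. x) = (\<Sum>i<N. beta lam i)"
    unfolding beta_set_truncate(1)[OF assms(2)]
    by (subst sum.reindex) (auto simp: inj_on_def beta_eq_iff[OF assms(1)])
  also have "\<dots> = int (psize lam) - (\<Sum>i<N. int (i + 1))"
    by (simp add: psize_eq_sum[OF assms(2)] beta_def sum_subtractf sum.distrib algebra_simps)
  moreover have "2 * (\<Sum>i<N. int (i + 1)) = int N * (int N + 1)"
    by (induction N) (auto simp: algebra_simps)
  ultimately show ?thesis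
    by simp
qed

lemma card_beta_set_truncate:
  assumes "partition lam" "\<forall>i\<ge>N. lam i = 0"
  shows "card (beta_set lam \<inter> {- int N..}) = N"
  unfolding beta_set_truncate(1)[OF assms(2)]
  by (subst card_image) (auto simp: inj_on_def beta_eq_iff[OF assms(1)])

text \<open>\<open>beta\<close> is strictly decreasing, so \<open>beta lam i\<close> is recovered
  from the beta-set as its element with exactly \<open>i\<close> larger elements.\<close>

lemma beta_set_inject:
  assumes "partition lam" "partition mu" "beta_set lam = beta_set mu"
  shows "lam = mu"
proof
  fix i
  have card: "card {y \<in> beta_set nu. beta nu k < y} = k" if "partition nu" for nu k
  proof -
    have "{y \<in> beta_set nu. beta nu k < y} = beta nu ` {..<k}"
      by (auto simp: beta_set_eq_range beta_less_iff[OF that])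
    then show ?thesis
      by (simp add: card_image inj_on_def beta_eq_iff[OF that])
  qed
  have "beta lam i \<in> beta_set mu"
    using assms(3) by (auto simp: beta_set_eq_range)
  then obtain k where k: "beta lam i = beta mu k"
    by (auto simp: beta_set_eq_range)
  have "i = k"
    using card[OF assms(1), of i] card[OF assms(2), of k] k assms(3) by simp
  with k show "lam i = mu i"
    by (simp add: beta_def)
qed

text \<open>Listing the window in decreasing order gives the nonzero part of the sequence; the
  cardinality \<open>N\<close> is what makes the list join up with the ray below
  \<open>- int N\<close>.\<close>

lemma beta_set_exists:
  assumes below: "\<And>x. x < - int N \<Longrightarrow> x \<in> B"
    and fin: "finite (B \<inter> {- int N..})" and card: "card (B \<inter> {- int N..}) = N"
  shows "\<exists>lam. partition lam \<and> beta_set lam = B"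
proof -
  define xs where "xs = sorted_list_of_set (B \<inter> {- int N..})"
  have len: "length xs = N" and set: "set xs = B \<inter> {- int N..}"
    using fin card by (auto simp: xs_def)
  have less: "xs ! i < xs ! j" if "i < j" "j < N" for i j
    using that len strict_sorted_list_of_set[of "B \<inter> {- int N..}"]
    by (auto simp: sorted_wrt_iff_nth_less xs_def[symmetric])
  \<comment> \<open>A strictly increasing integer list starting at \<open>- int N\<close> or later
    grows by at least 1 per entry; this keeps the parts nonnegative, so the \<open>nat\<close> in
    \<open>lam\<close> truncates nothing.\<close>
  have low: "k < N \<Longrightarrow> xs ! k \<ge> int k - int N" for k
  proof (induction k)
    case 0
    then have "xs ! 0 \<in> set xs" using len by auto
    then show ?case using set by auto
  next
    case (Suc k)
    then show ?case using less[of k "Suc k"] by auto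
  qed
  \<comment> \<open>\<open>xs\<close> increases while \<open>beta\<close> decreases, hence the
    reversed index \<open>N - 1 - i\<close>.\<close>
  define lam where
    "lam i = (if i < N then nat (xs ! (N - 1 - i) + int (i + 1)) else 0)" for i
  have b1: "beta lam i = xs ! (N - 1 - i)" if "i < N" for i
    using low[of "N - 1 - i"] that by (simp add: lam_def beta_def of_nat_diff)
  have zero: "\<forall>i\<ge>N. lam i = 0"
    by (simp add: lam_def)
  have "lam (Suc i) \<le> lam i" for i
  proof (cases "Suc i < N")
    case True
    then have "beta lam (Suc i) < beta lam i"
      using b1[of i] b1[of "Suc i"] less[of "N - 1 - Suc i" "N - 1 - i"] by simp
    then show ?thesis by (simp add: beta_def)
  qed (simp add: lam_def)
  then have "antimono lam"
    by (simp add: decseq_Suc_iff)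
  then have part: "partition lam"
    using zero partition_iff by blast
  have "beta lam ` {..<N} = set xs"
  proof -
    have "beta lam ` {..<N} = (\<lambda>i. xs ! (N - 1 - i)) ` {..<N}"
      using b1 by auto
    also have "\<dots> = (\<lambda>i. xs ! i) ` {..<N}"
    proof -
      have "x \<in> (\<lambda>i. N - 1 - i) ` {..<N}" if "x < N" for x
        using that by (intro image_eqI[of _ _ "N - 1 - x"]) auto
      then have "(\<lambda>i. N - 1 - i) ` {..<N} = {..<N}"
        by auto
      then show ?thesis
        by (metis image_image)
    qed
    finally show ?thesis
      by (auto simp: set_conv_nth len)
  qed
  then have "beta_set lam \<inter> {- int N..} = B \<inter> {- int N..}"
    using beta_set_truncate(1)[OF zero] set by simp
  moreover have "x \<in> beta_set lam \<longleftrightarrow> x \<in> B" if "x < - int N" for x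
    using beta_set_truncate(2)[OF zero that] below[OF that] by simp
  ultimately have "beta_set lam = B"
    unfolding set_eq_iff Int_iff atLeast_iff by (metis not_le)
  with part show ?thesis by blast
qed

section \<open>Gaps of the beta-set and hook lengths\<close>

lemma less_conjugate_iff:
  assumes "partition lam"
  shows "i < conjugate lam c \<longleftrightarrow> c < lam i"
proof -
  obtain N where N: "\<forall>i\<ge>N. lam i = 0"
    using assms partition_iff by blast
  have fin: "finite {i. c < lam i}"
    by (rule finite_subset[of _ "{..<N}"]) (use N in \<open>auto simp: not_le[symmetric]\<close>)
  have down: "j < lam i'" if "i' \<le> i" "j < lam i" for i i' j
    using partition_antimono[OF assms that(1)] that(2) by simp
  show ?thesis
  proof
    assume "c < lam i"
    then have "{..i} \<subseteq> {i. c < lam i}"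
      using down by auto
    from card_mono[OF fin this] show "i < conjugate lam c"
      by (simp add: conjugate_def)
  next
    assume i: "i < conjugate lam c"
    show "c < lam i"
    proof (rule ccontr)
      assume "\<not> c < lam i"
      then have "{i. c < lam i} \<subseteq> {..<i}"
        using down by (auto simp: not_le[symmetric])
      from card_mono[OF _ this] i show False
        by (simp add: conjugate_def)
    qed
  qed
qed

text \<open>The vertical steps of the boundary of the diagram are recorded by the beta-set, the horizontal
  ones by its complement, and a hook joins a vertical step to a horizontal one.\<close>

lemma not_in_beta_set_iff:
  assumes "partition lam"
  shows "x \<notin> beta_set lam \<longleftrightarrow> (\<exists>c. x = int c - int (conjugate lam c))"
proof
  assume x: "x \<notin> beta_set lam"
  obtain N where N: "\<forall>i\<ge>N. lam i = 0"
    using assms partition_iff by blast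
  have "beta lam (max N (nat (- x))) < x"
    using N by (simp add: beta_def)
  then have ex: "\<exists>i. beta lam i < x" ..
  \<comment> \<open>\<open>i\<close> counts the elements of the beta-set above \<open>x\<close>. It
    has to be the height of the column sought, which forces \<open>c = x + i\<close>.\<close>
  define i where "i = (LEAST i. beta lam i < x)"
  have i: "beta lam i < x"
    using ex unfolding i_def by (rule LeastI_ex)
  have i': "x < beta lam k" if "k < i" for k
    using not_less_Least[of k "\<lambda>i. beta lam i < x"] that x
    by (auto simp: i_def beta_set_eq_range not_less order_le_less)
  define c where "c = nat (x + int i)"
  have c: "int c = x + int i" "lam i \<le> c"
    using i by (auto simp: c_def beta_def)
  have "conjugate lam c = i"
  proof (rule antisym)
    show "conjugate lam c \<le> i"
      using less_conjugate_iff[OF assms, of i c] c by simp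
    show "i \<le> conjugate lam c"
    proof (cases i)
      case (Suc k)
      have "c < lam k"
        using i'[of k] c Suc by (simp add: beta_def)
      then show ?thesis
        using less_conjugate_iff[OF assms, of k c] Suc by simp
    qed simp
  qed
  with c show "\<exists>c. x = int c - int (conjugate lam c)"
    by (intro exI[of _ c]) simp
next
  assume "\<exists>c. x = int c - int (conjugate lam c)"
  then obtain c where c: "x = int c - int (conjugate lam c)" ..
  have "beta lam i \<noteq> x" for i
    using less_conjugate_iff[OF assms, of i c] c
    by (cases "i < conjugate lam c") (auto simp: beta_def)
  then show "x \<notin> beta_set lam"
    by (auto simp: beta_set_eq_range)
qed

text \<open>The hook at \<open>(r, c)\<close> has length
  \<open>beta lam r - (c - conjugate lam c)\<close>, and the subtracted numbers are exactly the gaps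
  of the beta-set. So row \<open>r\<close> has a hook of length \<open>n\<close> iff
  \<open>beta lam r - n\<close> is a gap.\<close>

lemma cores_iff:
  assumes "n \<ge> 1"
  shows "lam \<in> cores n \<longleftrightarrow> partition lam \<and> (\<forall>x\<in>beta_set lam. x - int n \<in> beta_set lam)"
proof (cases "partition lam")
  case True
  have "(\<exists>c<lam r. hook_length lam r c = int n) \<longleftrightarrow> beta lam r - int n \<notin> beta_set lam" for r
  proof -
    have "(\<exists>c<lam r. hook_length lam r c = int n) \<longleftrightarrow>
        (\<exists>c. beta lam r - int n = int c - int (conjugate lam c))"
    proof
      assume "\<exists>c<lam r. hook_length lam r c = int n"
      then show "\<exists>c. beta lam r - int n = int c - int (conjugate lam c)"
        by (auto simp: hook_length_def beta_def algebra_simps)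
    next
      assume "\<exists>c. beta lam r - int n = int c - int (conjugate lam c)"
      then obtain c where c: "beta lam r - int n = int c - int (conjugate lam c)" ..
      \<comment> \<open>Outside the diagram, \<open>lam r \<le> c\<close> and
        \<open>conjugate lam c \<le> r\<close> would make the hook expression negative, whereas it
        equals \<open>n \<ge> 1\<close>.\<close>
      have "c < lam r"
        using assms less_conjugate_iff[OF True, of r c] c unfolding beta_def by linarith
      moreover have "hook_length lam r c = int n"
        using c by (simp add: hook_length_def beta_def)
      ultimately show "\<exists>c<lam r. hook_length lam r c = int n" by blast
    qed
    then show ?thesis
      using not_in_beta_set_iff[OF True] by simp
  qed
  then show ?thesis
    using True unfolding cores_def young_diagram_def beta_set_eq_range by blast
qed (simp add: cores_def)

section \<open>Residue representatives of a core\<close>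

text \<open>In the class of \<open>j\<close> modulo \<open>n\<close> the condition
  \<open>x < a x\<close> cuts out the progression \<open>j + n * k\<close> with
  \<open>k < q j\<close>. The window starts at a multiple of \<open>n\<close>, so every class has
  the same lower bound \<open>- M\<close>.\<close>

lemma sum_truncate_residues:
  fixes a :: "int \<Rightarrow> int" and g :: "int \<Rightarrow> int"
  assumes "n \<ge> 1" and a: "\<And>j. j \<in> {0..<int n} \<Longrightarrow> a j = j + int n * q j"
    and per: "\<And>x y. [x = y] (mod int n) \<Longrightarrow> a x = a y"
  shows "finite ({x. x < a x} \<inter> {- int (n * M)..})"
    and "(\<Sum>x\<in>{x. x < a x} \<inter> {- int (n * M)..}. g x) =
      (\<Sum>j=0..<int n. \<Sum>k=- int M..<q j. g (j + int n * k))"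
proof -
  let ?P = "SIGMA j:{0..<int n}. {- int M..<q j}"
  let ?f = "\<lambda>(j, k). j + int n * k"
  have n: "int n > 0" using assms(1) by simp
  have inj: "inj_on ?f ?P"
  proof (rule inj_onI, clarify)
    fix j k j' k'
    assume *: "j \<in> {0..<int n}" "j' \<in> {0..<int n}" "j + int n * k = j' + int n * k'"
    have "j = (j + int n * k) mod int n"
      using *(1) by simp
    also have "\<dots> = (j' + int n * k') mod int n"
      by (simp only: *(3))
    also have "\<dots> = j'"
      using *(2) by simp
    finally have "j = j'" .
    with * n show "j = j' \<and> k = k'" by simp
  qed
  have im: "?f ` ?P = {x. x < a x} \<inter> {- int (n * M)..}"
  proof (intro equalityI subsetI)
    fix x assume "x \<in> ?f ` ?P"
    then obtain j k where jk: "j \<in> {0..<int n}" "- int M \<le> k" "k < q j" "x = j + int n * k"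
      by auto
    have "a x = a j"
      by (rule per) (simp add: jk cong_def)
    then have "x < a x"
      using a[OF jk(1)] jk n by simp
    moreover have "int n * - int M \<le> int n * k"
      using jk n by (intro mult_left_mono) auto
    then have "x \<ge> - int (n * M)"
      using jk by simp
    ultimately show "x \<in> {x. x < a x} \<inter> {- int (n * M)..}" by simp
  next
    fix x assume x: "x \<in> {x. x < a x} \<inter> {- int (n * M)..}"
    let ?j = "x mod int n" and ?k = "x div int n"
    have j: "?j \<in> {0..<int n}" using n by simp
    have eq: "x = ?j + int n * ?k" by simp
    have "a x = a ?j"
      by (rule per) (simp add: cong_def)
    then have "?j + int n * ?k < ?j + int n * q ?j"
      using x a[OF j] by simp
    then have "int n * ?k < int n * q ?j"
      using eq by linarith
    then have "?k < q ?j"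
      using n by (simp only: mult_less_cancel_left_pos)
    moreover have "- int M \<le> ?k"
    proof -
      have "(- int M) * int n div int n \<le> x div int n"
        using x n by (intro zdiv_mono1) (auto simp: mult.commute)
      moreover have "(- int M) * int n div int n = - int M"
        using n by (intro nonzero_mult_div_cancel_right) simp
      ultimately show ?thesis by simp
    qed
    ultimately have "(?j, ?k) \<in> ?P"
      using j by simp
    then show "x \<in> ?f ` ?P"
      using eq by force
  qed
  show "finite ({x. x < a x} \<inter> {- int (n * M)..})"
    unfolding im[symmetric] by (intro finite_imageI finite_SigmaI) auto
  show "(\<Sum>x\<in>{x. x < a x} \<inter> {- int (n * M)..}. g x) =
      (\<Sum>j=0..<int n. \<Sum>k=- int M..<q j. g (j + int n * k))"
    unfolding im[symmetric] sum.reindex[OF inj] by (simp add: sum.Sigma case_prod_unfold)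
qed

definition residue_reps :: "nat \<Rightarrow> (int \<Rightarrow> int) \<Rightarrow> bool" where
  "residue_reps n a \<longleftrightarrow>
     (\<forall>x y. [x = y] (mod int n) \<longrightarrow> a x = a y) \<and> (\<forall>x. [a x = x] (mod int n)) \<and>
     (\<Sum>x=0..<int n. a x) = int (n choose 2)"

lemma sum_int_range: "(\<Sum>x=0..<int n. x) = int (n choose 2)"
proof -
  have "(\<Sum>x=0..<int n. x) = (\<Sum>i<n. int i)"
    by (rule sum.reindex_bij_witness[of _ int nat]) auto
  also have "\<dots> = int (n choose 2)"
    by (induction n) (auto simp: numeral_2_eq_2)
  finally show ?thesis .
qed

lemma two_sum_int_atLeastLessThan:
  fixes q :: int
  assumes "q \<ge> - int M"
  shows "2 * (\<Sum>k=- int M..<q. k) = q * (q - 1) - int M * (int M + 1)"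
  using assms
proof (induction q rule: int_ge_induct)
  case (step i)
  have "{- int M..<i + 1} = insert i {- int M..<i}"
    using step by auto
  then show ?case
    using step by (simp add: algebra_simps)
qed (simp add: algebra_simps)

lemma cong_imp_ex_quotient:
  fixes a :: "int \<Rightarrow> int"
  assumes "\<forall>x. [a x = x] (mod int n)"
  shows "\<exists>q. \<forall>x. a x = x + int n * q x"
proof -
  have "\<exists>k. a x = x + int n * k" for x
    using assms cong_sym[of "a x" x] by (simp add: cong_iff_lin)
  then show ?thesis by (rule choice[OF allI])
qed

lemma two_choose_two: "2 * int (n choose 2) = int n * (int n - 1)"
  by (induction n) (auto simp: numeral_2_eq_2 algebra_simps)

text \<open>Class \<open>j\<close> contributes \<open>q j + M\<close> elements. Hence the window has
  the \<open>n * M\<close> elements required of a beta-set iff the representatives sum to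
  \<open>n choose 2\<close>; both directions are used below.\<close>

lemma card_truncate_residues:
  assumes "n \<ge> 1" and per: "\<And>x y. [x = y] (mod int n) \<Longrightarrow> a x = a y"
    and a: "\<And>x. a x = x + int n * q x" and M: "\<forall>j\<in>{0..<int n}. - int M \<le> q j"
  shows "int n * int (card ({x. x < a x} \<inter> {- int (n * M)..})) =
      (\<Sum>x=0..<int n. a x) - int (n choose 2) + int n * int (n * M)"
proof -
  have "int (card ({x. x < a x} \<inter> {- int (n * M)..})) =
      (\<Sum>x\<in>{x. x < a x} \<inter> {- int (n * M)..}. 1)"
    by simp
  also have "\<dots> = (\<Sum>j=0..<int n. \<Sum>k=- int M..<q j. 1)"
    using a by (intro sum_truncate_residues(2)[OF assms(1) _ per]) auto
  also have "\<dots> = (\<Sum>j=0..<int n. q j + int M)"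
    using M by (intro sum.cong refl) (force simp: algebra_simps)
  finally have "int n * int (card ({x. x < a x} \<inter> {- int (n * M)..})) =
      (\<Sum>j=0..<int n. int n * q j) + int n * int (n * M)"
    by (simp add: sum.distrib sum_distrib_left algebra_simps)
  moreover have "(\<Sum>x=0..<int n. a x) = int (n choose 2) + (\<Sum>j=0..<int n. int n * q j)"
    by (subst a) (simp add: sum.distrib sum_int_range)
  ultimately show ?thesis by simp
qed

text \<open>All larger bounds are included because \<open>M\<close> also has to be large enough for
  the parts from index \<open>n * M\<close> on to vanish.\<close>

lemma ex_lower_bound:
  fixes q :: "int \<Rightarrow> int"
  shows "\<exists>M. \<forall>M'\<ge>M. \<forall>j\<in>{0..<int n}. - int M' \<le> q j"
proof -
  have "- int M' \<le> q j" if "M' \<ge> nat (\<Sum>j=0..<int n. \<bar>q j\<bar>)" "j \<in> {0..<int n}" for M' j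
  proof -
    have "\<bar>q j\<bar> \<le> (\<Sum>j=0..<int n. \<bar>q j\<bar>)"
      using that by (intro member_le_sum) auto
    then show ?thesis using that by linarith
  qed
  then show ?thesis by blast
qed

text \<open>The sum condition gives the window the right cardinality for a beta-set, and periodicity
  of \<open>a\<close> makes \<open>{x. x < a x}\<close> closed under subtracting
  \<open>n\<close>.\<close>

lemma core_of_residue_reps:
  assumes "n \<ge> 1" "residue_reps n a"
  shows "\<exists>lam\<in>cores n. beta_set lam = {x. x < a x}"
proof -
  have per: "\<And>x y. [x = y] (mod int n) \<Longrightarrow> a x = a y"
    and sum: "(\<Sum>x=0..<int n. a x) = int (n choose 2)" and "\<forall>x. [a x = x] (mod int n)"
    using assms(2) unfolding residue_reps_def by blast+
  then obtain q where q: "\<And>x. a x = x + int n * q x"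
    using cong_imp_ex_quotient by blast
  obtain M where M: "\<forall>j\<in>{0..<int n}. - int M \<le> q j"
    using ex_lower_bound by blast
  have "int n * int (card ({x. x < a x} \<inter> {- int (n * M)..})) = int n * int (n * M)"
    using card_truncate_residues[OF assms(1) per q M] sum by simp
  then have "int (card ({x. x < a x} \<inter> {- int (n * M)..})) = int (n * M)"
    using assms(1) by (simp del: of_nat_mult)
  then have card: "card ({x. x < a x} \<inter> {- int (n * M)..}) = n * M"
    by (simp only: of_nat_eq_iff)
  have below: "x \<in> {x. x < a x}" if "x < - int (n * M)" for x
  proof -
    have n: "int n > 0" using assms(1) by simp
    have "a x = a (x mod int n)"
      by (rule per) (simp add: cong_def)
    also have "\<dots> \<ge> int n * - int M"
    proof -
      have "int n * - int M \<le> int n * q (x mod int n)"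
        using M n by (intro mult_left_mono) auto
      then show ?thesis
        using n pos_mod_sign[OF n, of x] by (simp only: q)
    qed
    finally show ?thesis using that by simp
  qed
  have fin: "finite ({x. x < a x} \<inter> {- int (n * M)..})"
    by (rule sum_truncate_residues(1)[OF assms(1) q per])
  obtain lam where lam: "partition lam" "beta_set lam = {x. x < a x}"
    using beta_set_exists[OF below fin card] by blast
  have "a (x - int n) = a x" for x
    by (rule per) (simp add: cong_def)
  then have "lam \<in> cores n"
    using lam assms(1) by (simp add: cores_iff)
  with lam show ?thesis by blast
qed

text \<open>The beta-set of an \<open>n\<close>-core meets each residue class in a ray that is
  bounded above; \<open>a\<close> picks the first gap beyond that ray. Counting the window then
  yields the sum of the representatives.\<close>

lemma residue_reps_of_core:
  assumes "n \<ge> 1" "lam \<in> cores n"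
  shows "\<exists>a. residue_reps n a \<and> beta_set lam = {x. x < a x}"
proof -
  have part: "partition lam" and down: "\<And>x. x \<in> beta_set lam \<Longrightarrow> x - int n \<in> beta_set lam"
    using assms cores_iff by blast+
  obtain N where N: "\<forall>i\<ge>N. lam i = 0"
    using part partition_iff by blast
  have n: "int n > 0" using assms(1) by simp
  have down': "x - int n * int k \<in> beta_set lam" if "x \<in> beta_set lam" for x k
  proof (induction k)
    case (Suc k)
    show ?case using down[OF Suc] by (simp add: algebra_simps)
  qed (use that in simp)
  have ex: "\<exists>k. x + int n * int k - int n * int K \<notin> beta_set lam" for x K
  proof -
    have "beta lam i \<le> int (lam 0)" for i
      using partition_antimono[OF part, of 0 i] by (simp add: beta_def)
    moreover have "x + int n * int (nat (\<bar>x\<bar> + int (lam 0) + 1)) > int (lam 0)"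
    proof -
      have "1 * int (nat (\<bar>x\<bar> + int (lam 0) + 1)) \<le> int n * int (nat (\<bar>x\<bar> + int (lam 0) + 1))"
        using n by (intro mult_right_mono) auto
      then show ?thesis by linarith
    qed
    ultimately have "x + int n * int (nat (\<bar>x\<bar> + int (lam 0) + 1)) \<notin> beta_set lam"
      by (auto simp: beta_set_eq_range not_le[symmetric])
    then show ?thesis
      by (intro exI[of _ "nat (\<bar>x\<bar> + int (lam 0) + 1) + K"]) (simp add: algebra_simps)
  qed
  define first_gap where
    "first_gap r y \<longleftrightarrow> [y = r] (mod int n) \<and> y \<notin> beta_set lam \<and> y - int n \<in> beta_set lam" for r y
  have gap: "\<exists>y. first_gap r y" for r
  proof -
    \<comment> \<open>\<open>K\<close> is large enough that \<open>r - n * K\<close> lies below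
      \<open>- N\<close>, hence in the beta-set; the search for a gap moves upwards from there in
      steps of \<open>n\<close>.\<close>
    define K where "K = nat (\<bar>r\<bar> + int N) + 1"
    have K: "int K = \<bar>r\<bar> + int N + 1"
      by (simp add: K_def)
    let ?P = "\<lambda>k. r + int n * int k - int n * int K \<notin> beta_set lam"
    define k where "k = (LEAST k. ?P k)"
    have k: "?P k"
      unfolding k_def by (rule LeastI_ex) (rule ex)
    have "r - int n * int K < - int N"
    proof -
      have "1 * int K \<le> int n * int K"
        using n by (intro mult_right_mono) auto
      then show ?thesis using K by linarith
    qed
    then have "\<not> ?P 0"
      using beta_set_truncate(2)[OF N] by simp
    then obtain k' where k': "k = Suc k'"
      using k by (cases k) auto
    have "\<not> ?P k'"
      using not_less_Least[of k' ?P] k' by (simp add: k_def)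
    then have "r + int n * int k - int n * int K - int n \<in> beta_set lam"
      by (simp add: k' algebra_simps)
    moreover have "[r + int n * int k - int n * int K = r] (mod int n)"
      by (simp add: cong_iff_dvd_diff)
    ultimately show ?thesis
      using k unfolding first_gap_def by blast
  qed
  have above: "x \<notin> beta_set lam" if y: "y \<notin> beta_set lam" "[x = y] (mod int n)" "y \<le> x" for x y
  proof
    assume x: "x \<in> beta_set lam"
    obtain k where k: "x - y = int n * k"
      using y(2) by (auto simp: cong_iff_dvd_diff)
    then have "k \<ge> 0"
      using y(3) n by (smt (verit) mult_nonneg_nonpos zero_le_mult_iff)
    then have "y = x - int n * int (nat k)"
      using k by simp
    then show False
      using down'[OF x] y(1) by metis
  qed
  \<comment> \<open>Choosing through \<open>r mod int n\<close> makes \<open>a\<close> constant on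
    residue classes by construction.\<close>
  define a where "a r = (SOME y. first_gap (r mod int n) y)" for r
  have a: "first_gap (r mod int n) (a r)" for r
    unfolding a_def using gap by (rule someI_ex)
  have per: "a x = a y" if "[x = y] (mod int n)" for x y
    using that by (simp add: a_def cong_def)
  have cong: "[a x = x] (mod int n)" for x
    using a[of x] by (simp add: first_gap_def cong_def)
  have eq: "beta_set lam = {x. x < a x}"
  proof (intro equalityI subsetI CollectI)
    fix x assume x: "x \<in> beta_set lam"
    show "x < a x"
    proof (rule ccontr)
      assume "\<not> x < a x"
      then show False
        using above[of "a x" x] a[of x] cong_sym[OF cong[of x]] x by (simp add: first_gap_def)
    qed
  next
    fix x assume "x \<in> {x. x < a x}"
    then have x: "x < a x" by simp
    obtain k where k: "a x - x = int n * k"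
      using cong[of x] by (auto simp: cong_iff_dvd_diff)
    then have "int n * k > 0" using x by linarith
    then have "k \<ge> 1"
      using n by (simp add: zero_less_mult_iff)
    then have "x = (a x - int n) - int n * int (nat (k - 1))"
      using k by (simp add: algebra_simps)
    then show "x \<in> beta_set lam"
      using down'[of "a x - int n" "nat (k - 1)"] a[of x] by (simp add: first_gap_def)
  qed
  obtain q where q: "\<And>x. a x = x + int n * q x"
    using cong_imp_ex_quotient cong by blast
  obtain M0 where M0: "\<forall>M\<ge>M0. \<forall>j\<in>{0..<int n}. - int M \<le> q j"
    using ex_lower_bound by blast
  \<comment> \<open>\<open>M0\<close> serves the class-by-class count, \<open>N\<close> the count of
    the window through the parts.\<close>
  define M where "M = max M0 N"
  have "n * M \<ge> 1 * M" using assms(1) by (intro mult_le_mono1)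
  then have "\<forall>i\<ge>n * M. lam i = 0"
    using N by (auto simp: M_def)
  from card_beta_set_truncate[OF part this]
  have "(\<Sum>x=0..<int n. a x) = int (n choose 2)"
    using card_truncate_residues[OF assms(1) per q, of M] M0 eq by (simp add: M_def)
  then show ?thesis
    using eq per cong by (auto simp: residue_reps_def)
qed

text \<open>Sum the window class by class. The quotients \<open>q j\<close> sum to 0, so the
  dependence on the cutoff \<open>M\<close> reduces to the triangular number that
  \<open>psize_eq_sum_beta_set\<close> adds back.\<close>

lemma psize_residue_reps:
  assumes "n \<ge> 1" "partition lam" "residue_reps n a" "beta_set lam = {x. x < a x}"
  shows "2 * int n * int (psize lam) = (\<Sum>x=0..<int n. (a x)\<^sup>2 - x\<^sup>2)"
proof -
  have per: "\<And>x y. [x = y] (mod int n) \<Longrightarrow> a x = a y"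
    and sum: "(\<Sum>x=0..<int n. a x) = int (n choose 2)" and "\<forall>x. [a x = x] (mod int n)"
    using assms(3) unfolding residue_reps_def by blast+
  then obtain q where q: "\<And>x. a x = x + int n * q x"
    using cong_imp_ex_quotient by blast
  obtain N where N: "\<forall>i\<ge>N. lam i = 0"
    using assms(2) partition_iff by blast
  obtain M0 where M0: "\<forall>M\<ge>M0. \<forall>j\<in>{0..<int n}. - int M \<le> q j"
    using ex_lower_bound by blast
  define M where "M = max M0 N"
  have "n * M \<ge> 1 * M" using assms(1) by (intro mult_le_mono1)
  then have zero: "\<forall>i\<ge>n * M. lam i = 0"
    using N by (auto simp: M_def)
  have M: "\<And>j. j \<in> {0..<int n} \<Longrightarrow> - int M \<le> q j"
    using M0 by (simp add: M_def)
  have q0: "(\<Sum>j=0..<int n. q j) = 0"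
  proof -
    have "(\<Sum>x=0..<int n. a x) = int (n choose 2) + int n * (\<Sum>j=0..<int n. q j)"
      by (subst q) (simp add: sum.distrib sum_int_range sum_distrib_left)
    then show ?thesis using sum assms(1) by simp
  qed
  have "2 * (\<Sum>x\<in>{x. x < a x} \<inter> {- int (n * M)..}. x) =
      2 * (\<Sum>j=0..<int n. \<Sum>k=- int M..<q j. j + int n * k)"
    using q by (subst sum_truncate_residues(2)[OF assms(1) _ per]) auto
  also have "\<dots> = (\<Sum>j=0..<int n. 2 * j * (q j + int M) + int n * (2 * (\<Sum>k=- int M..<q j. k)))"
  proof -
    have "2 * (\<Sum>k=- int M..<q j. j + int n * k) =
        2 * j * (q j + int M) + int n * (2 * (\<Sum>k=- int M..<q j. k))" if "j \<in> {0..<int n}" for j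
      using M[OF that] by (simp add: sum.distrib sum_distrib_left algebra_simps)
    then show ?thesis
      unfolding sum_distrib_left[of 2] by simp
  qed
  also have "\<dots> = (\<Sum>j=0..<int n. 2 * j * (q j + int M) +
      int n * (q j * (q j - 1) - int M * (int M + 1)))"
    using M by (intro sum.cong refl) (simp add: two_sum_int_atLeastLessThan)
  also have "\<dots> = (\<Sum>j=0..<int n. (2 * j * q j + int n * (q j)\<^sup>2) - int n * q j + 2 * int M * j
      - int n * (int M * (int M + 1)))"
    by (intro sum.cong refl) (simp add: algebra_simps power2_eq_square)
  also have "\<dots> = (\<Sum>j=0..<int n. 2 * j * q j + int n * (q j)\<^sup>2) - int n * (\<Sum>j=0..<int n. q j)
      + int M * (2 * (\<Sum>j=0..<int n. j)) - int n * (int n * (int M * (int M + 1)))"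
    by (simp add: sum.distrib sum_subtractf sum_distrib_left algebra_simps)
  also have "\<dots> = (\<Sum>j=0..<int n. 2 * j * q j + int n * (q j)\<^sup>2)
      - int (n * M) * (int (n * M) + 1)"
    unfolding q0 sum_int_range two_choose_two by (simp add: algebra_simps)
  finally have "2 * int (psize lam) = (\<Sum>j=0..<int n. 2 * j * q j + int n * (q j)\<^sup>2)"
    using psize_eq_sum_beta_set[OF assms(2) zero] assms(4) by simp
  then have "int n * (2 * int (psize lam)) = int n * (\<Sum>j=0..<int n. 2 * j * q j + int n * (q j)\<^sup>2)"
    by simp
  \<comment> \<open>With \<open>a x = x + n * q x\<close>, the difference of squares is
    \<open>n * (2 * x * q x + n * (q x)^2)\<close>.\<close>
  also have "\<dots> = (\<Sum>x=0..<int n. (a x)\<^sup>2 - x\<^sup>2)"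
    unfolding sum_distrib_left
    by (intro sum.cong refl) (subst q, simp add: algebra_simps power2_eq_square)
  finally show ?thesis by (simp add: algebra_simps)
qed

text \<open>A point \<open>x\<close> of the \<open>n\<close>-set satisfies
  \<open>x - n < a x \<le> x\<close>; as \<open>a x\<close> is congruent to \<open>x\<close> modulo
  \<open>n\<close>, this forces \<open>a x = x\<close>, and the fixed points of \<open>a\<close> are
  its range.\<close>

lemma s_set_residue_reps:
  assumes "n \<ge> 1" "residue_reps n a" "beta_set lam = {x. x < a x}"
  shows "s_set n lam = range a"
proof -
  have per: "\<And>x y. [x = y] (mod int n) \<Longrightarrow> a x = a y" and cong: "\<And>x. [a x = x] (mod int n)"
    using assms(2) unfolding residue_reps_def by blast+
  have "a (x - int n) = a x" for x
    by (rule per) (simp add: cong_def)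
  moreover have "(\<lambda>b. b + int n) ` B = {x. x - int n \<in> B}" for B
  proof (intro equalityI subsetI)
    fix x assume "x \<in> {x. x - int n \<in> B}"
    then show "x \<in> (\<lambda>b. b + int n) ` B"
      by (intro image_eqI[of _ _ "x - int n"]) auto
  qed auto
  ultimately have *: "s_set n lam = {x. x - int n < a x \<and> a x \<le> x}"
    unfolding s_set_def assms(3) by auto
  show ?thesis
  proof (intro equalityI subsetI)
    fix x assume "x \<in> s_set n lam"
    then have x: "0 \<le> x - a x" "x - a x < int n" using * by auto
    have "(x - a x) mod int n = 0"
      using cong_sym[OF cong[of x]] by (simp add: cong_iff_dvd_diff)
    then have "x = a x"
      using x by simp
    then show "x \<in> range a" by (rule range_eqI)
  next
    fix x assume "x \<in> range a"
    then obtain y where y: "x = a y" by auto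
    have "a x = x"
      unfolding y by (rule per) (rule cong)
    then show "x \<in> s_set n lam"
      using assms(1) * by simp
  qed
qed

lemma residue_repsD:
  assumes "residue_reps n a"
  shows "[x = y] (mod int n) \<Longrightarrow> a x = a y" and "[a x = x] (mod int n)"
    and "(\<Sum>x=0..<int n. a x) = int (n choose 2)" and "a (a x) = a x"
  using assms unfolding residue_reps_def by blast+

lemma residue_reps_mod: "residue_reps n a \<Longrightarrow> a (x mod int n) = a x"
  by (rule residue_repsD(1)) (auto simp: cong_def)

lemma residue_reps_range: "residue_reps n a \<Longrightarrow> y \<in> range a \<longleftrightarrow> a y = y"
  by (metis rangeE rangeI residue_repsD(4))

lemma bij_betw_residues:
  fixes a :: "int \<Rightarrow> int"
  assumes "n \<ge> 1" "\<And>x y. [x = y] (mod int n) \<Longrightarrow> a x = a y" "\<And>x. [a x = x] (mod int n)"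
  shows "bij_betw a {0..<int n} (range a)"
  unfolding bij_betw_def
proof (intro conjI inj_onI equalityI subsetI)
  fix x y assume "x \<in> {0..<int n}" "y \<in> {0..<int n}" "a x = a y"
  then show "x = y"
    using assms(3)[of x] assms(3)[of y] by (simp add: cong_def)
next
  fix y assume "y \<in> range a"
  then obtain x where "y = a x" by auto
  also have "\<dots> = a (x mod int n)"
    by (rule assms(2)) (simp add: cong_def)
  finally show "y \<in> a ` {0..<int n}"
    using assms(1) by simp
qed auto

text \<open>The range meets each residue class exactly once, so it determines the value on that
  class.\<close>

lemma residue_reps_eqI:
  assumes "residue_reps n a" "residue_reps n b" "range a = range b"
  shows "a = b"
proof
  fix x
  have "b (a x) = a x"
    using assms residue_reps_range by blast
  then show "a x = b x"
    using residue_repsD(1)[OF assms(2) residue_repsD(2)[OF assms(1), of x]] by simp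
qed

section \<open>Stabilizers\<close>

lemma s_set_inject:
  assumes "n \<ge> 1" "lam \<in> cores n" "mu \<in> cores n" "s_set n lam = s_set n mu"
  shows "lam = mu"
proof -
  obtain a where a: "residue_reps n a" "beta_set lam = {x. x < a x}"
    using residue_reps_of_core assms by blast
  obtain b where b: "residue_reps n b" "beta_set mu = {x. x < b x}"
    using residue_reps_of_core assms by blast
  have "a = b"
    using residue_reps_eqI[OF a(1) b(1)] s_set_residue_reps[OF assms(1)] a b assms(4) by simp
  then show ?thesis
    using beta_set_inject[of lam mu] a b assms by (auto simp: cores_def)
qed

lemma periodic_cong:
  fixes h :: "int \<Rightarrow> 'a"
  assumes step: "\<And>x. h (x + int n) = h x" and "[x = y] (mod int n)"
  shows "h x = h y"
proof -
  have nat: "h (x + int n * int k) = h x" for x k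
  proof (induction k)
    case (Suc k)
    then show ?case
      using step[of "x + int n * int k"] by (simp add: algebra_simps)
  qed simp
  obtain k where k: "x - y = int n * k"
    using assms(2) by (auto simp: cong_iff_dvd_diff)
  show ?thesis
  proof (cases "k \<ge> 0")
    case True
    then show ?thesis
      using nat[of y "nat k"] k by (simp add: algebra_simps)
  next
    case False
    then show ?thesis
      using nat[of x "nat (- k)"] k by (simp add: algebra_simps)
  qed
qed

lemma core_group_shift:
  assumes "f \<in> carrier (core_group s t)" "[x = y] (mod int s)"
  shows "f x - x = f y - y"
proof (rule periodic_cong[of "\<lambda>m. f m - m", OF _ assms(2)])
  show "f (m + int s) - (m + int s) = f m - m" for m
    using assms(1) by (simp add: core_group_def)
qed

lemma sum_lessThan_int: "(\<Sum>i<n. f (int i)) = (\<Sum>x=0..<int n. f x)"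
  by (rule sum.reindex_bij_witness[of _ nat int]) auto

text \<open>This makes the description in \<open>core_action\<close> meaningful. The image core is
  represented by the conjugate \<open>b\<close> of \<open>a\<close> under \<open>f\<close>: since
  \<open>f m - m\<close> depends only on \<open>m\<close> modulo \<open>s\<close>, \<open>b\<close>
  is again periodic and keeps residues, and its sum is unchanged.\<close>

lemma s_set_image_exists:
  assumes "s \<ge> 1" "lam \<in> cores s" "f \<in> carrier (core_group s t)"
  shows "\<exists>mu\<in>cores s. s_set s mu = f ` s_set s lam"
proof -
  obtain a where a: "residue_reps s a" "beta_set lam = {x. x < a x}"
    using residue_reps_of_core assms by blast
  have bij: "bij f" and sum_f: "(\<Sum>i=0..<int s. f i) = int (s choose 2)"
    using assms(3) by (simp_all add: core_group_def sum_lessThan_int)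
  define b where "b x = f (a (inv_into UNIV f x))" for x
  have inv: "f (inv_into UNIV f x) = x" "inv_into UNIV f (f x) = x" for x
    using bij by (simp_all add: bij_is_surj surj_f_inv_f bij_is_inj inv_f_f)
  have per: "b x = b y" if "[x = y] (mod int s)" for x y
  proof -
    have "[inv_into UNIV f x + (y - x) = inv_into UNIV f x] (mod int s)"
      using that by (simp add: cong_iff_dvd_diff dvd_diff_commute)
    from core_group_shift[OF assms(3) this]
    have "f (inv_into UNIV f x + (y - x)) = y"
      by (simp add: inv)
    then have "inv_into UNIV f y = inv_into UNIV f x + (y - x)"
      using inv(2)[of "inv_into UNIV f x + (y - x)"] by simp
    then have "[inv_into UNIV f x = inv_into UNIV f y] (mod int s)"
      using that by (simp add: cong_iff_dvd_diff)
    then show ?thesis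
      using residue_repsD(1)[OF a(1)] by (simp add: b_def)
  qed
  have cong: "[b x = x] (mod int s)" for x
  proof -
    have "b x - x = a (inv_into UNIV f x) - inv_into UNIV f x"
      using core_group_shift[OF assms(3) residue_repsD(2)[OF a(1), of "inv_into UNIV f x"]]
      by (simp add: b_def inv)
    then show ?thesis
      using residue_repsD(2)[OF a(1), of "inv_into UNIV f x"] by (simp add: cong_iff_dvd_diff)
  qed
  have range: "range b = f ` range a"
  proof -
    have "range (inv_into UNIV f) = UNIV"
      using bij by (simp add: bij_imp_bij_inv bij_is_surj)
    then have "f ` a ` range (inv_into UNIV f) = f ` range a" by simp
    then show ?thesis
      by (simp add: b_def image_image)
  qed
  have "(\<Sum>x=0..<int s. b x) = (\<Sum>y\<in>range b. y)"
    using sum.reindex_bij_betw[OF bij_betw_residues[OF assms(1) per cong], of "\<lambda>y. y"] by simp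
  also have "\<dots> = (\<Sum>y\<in>range a. f y)"
    unfolding range using bij by (subst sum.reindex) (auto simp: bij_def inj_on_def)
  also have "\<dots> = (\<Sum>x=0..<int s. f (a x))"
    using sum.reindex_bij_betw[OF bij_betw_residues[OF assms(1) residue_repsD(1,2)[OF a(1)]], of f]
    by simp
  \<comment> \<open>\<open>a x\<close> and \<open>x\<close> are congruent modulo \<open>s\<close>,
    so \<open>f\<close> displaces them equally.\<close>
  also have "\<dots> = (\<Sum>x=0..<int s. f x + a x - x)"
    using core_group_shift[OF assms(3) residue_repsD(2)[OF a(1)]]
    by (intro sum.cong refl) (simp add: algebra_simps)
  also have "\<dots> = int (s choose 2)"
    using sum_f residue_repsD(3)[OF a(1)] by (simp add: sum.distrib sum_subtractf sum_int_range)
  finally have b: "residue_reps s b"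
    using per cong by (auto simp: residue_reps_def)
  then obtain mu where "mu \<in> cores s" "beta_set mu = {x. x < b x}"
    using core_of_residue_reps assms(1) by blast
  then show ?thesis
    using s_set_residue_reps[OF assms(1) b, of mu] s_set_residue_reps[OF assms(1) a] range
    by (intro bexI[of _ mu]) simp_all
qed

lemma Stab_eq:
  assumes "s \<ge> 1" "lam \<in> cores s"
  shows "Stab s t lam = {f \<in> carrier (core_group s t). f ` s_set s lam = s_set s lam}"
proof -
  have "core_action s f lam = lam \<longleftrightarrow> f ` s_set s lam = s_set s lam"
    if f: "f \<in> carrier (core_group s t)" for f
  proof -
    obtain mu where mu: "mu \<in> cores s" "s_set s mu = f ` s_set s lam"
      using s_set_image_exists[OF assms f] by blast
    then have "core_action s f lam = mu"
      unfolding core_action_def using assms s_set_inject[OF assms(1)]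
      by (auto intro!: the_equality)
    then show ?thesis
      using mu s_set_inject[OF assms(1) mu(1) assms(2)] by auto
  qed
  then show ?thesis
    by (auto simp: stabilizer_def)
qed

text \<open>A group element is determined by its values on the \<open>s\<close>-set, which has one
  point in each class modulo \<open>s\<close>. So a stabilizing element amounts to a permutation
  \<open>p\<close> of the classes, sending \<open>a i\<close> to \<open>a (p i)\<close>, and
  periodicity of the displacement extends it to all integers.\<close>

lemma bij_betw_permutations_stabilizer:
  fixes s t :: nat and a :: "int \<Rightarrow> int"
  assumes "s \<ge> 1" and a: "residue_reps s a"
  defines "I \<equiv> {0..<int s}"
  shows "bij_betw (\<lambda>p m. a (p (m mod int s)) + m - a m)
    {p. p permutes I \<and> (\<forall>i\<in>I. [a (p i) = a i] (mod int t))}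
    {f \<in> carrier (core_group s t). f ` range a = range a}"
    (is "bij_betw ?lift ?H ?G")
proof (rule bij_betw_byWitness)
  let ?res = "\<lambda>f i. if i \<in> I then f (a i) mod int s else i"
  note aD = residue_repsD[OF a] and a_mod = residue_reps_mod[OF a] and a_range = residue_reps_range[OF a]
  have I: "x mod int s \<in> I" for x
    using assms(1) by (simp add: I_def)
  have I_mod: "i mod int s = i" if "i \<in> I" for i
    using that by (simp add: I_def)
  have mod_a: "a x mod int s = x mod int s" for x
    using aD(2)[of x] by (simp add: cong_def)
  have perm: "p i \<in> I" if "p permutes I" "i \<in> I" for p i
    using that by (simp add: permutes_in_image)
  have lift_a: "?lift p (a i) = a (p i)" if "i \<in> I" for p i
    using that by (simp add: mod_a I_mod aD(4))
  show "\<forall>p\<in>?H. ?res (?lift p) = p"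
  proof (intro ballI ext)
    fix p i assume p: "p \<in> ?H"
    show "?res (?lift p) i = p i"
    proof (cases "i \<in> I")
      case True
      then have "?res (?lift p) i = a (p i) mod int s"
        using lift_a[OF True, of p] by simp
      also have "\<dots> = p i"
        using mod_a perm[of p i] I_mod p True by simp
      finally show ?thesis .
    next
      case False
      then show ?thesis
        using p permutes_not_in[of p I i] by simp
    qed
  qed
  have a_res: "a (?res f i) = f (a i)" if "f \<in> ?G" "i \<in> I" for f i
  proof -
    have "f (a i) \<in> range a" using that by blast
    then show ?thesis
      using that by (simp add: a_mod a_range)
  qed
  show "\<forall>f\<in>?G. ?lift (?res f) = f"
  proof (intro ballI ext)
    fix f m assume f: "f \<in> ?G"
    have "?lift (?res f) m = f (a (m mod int s)) + m - a m"
      by (simp only: a_res[OF f I])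
    also have "\<dots> = f m"
      using core_group_shift[of f s t "a m" m] f aD(2)[of m] by (simp add: a_mod)
    finally show "?lift (?res f) m = f m" .
  qed
  show "?lift ` ?H \<subseteq> ?G"
  proof (intro image_subsetI)
    fix p assume "p \<in> ?H"
    then have p: "p permutes I" and pt: "\<And>i. i \<in> I \<Longrightarrow> [a (p i) = a i] (mod int t)" by auto
    \<comment> \<open>Lifting respects composition, so the lift of the inverse permutation is the
      inverse map, which gives bijectivity.\<close>
    have comp: "?lift p (?lift q m) = ?lift (p \<circ> q) m" if q: "q permutes I" for p q m
    proof -
      have "?lift q m mod int s = a (q (m mod int s)) mod int s"
        using aD(2)[of m] by (simp add: cong_iff_dvd_diff mod_eq_dvd_iff dvd_diff_commute)
      also have "\<dots> = q (m mod int s)"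
        using mod_a I_mod perm[OF q I] by simp
      finally have *: "?lift q m mod int s = q (m mod int s)" .
      then have "a (?lift q m) = a (q (m mod int s))"
        using a_mod by metis
      then show ?thesis
        using * by simp
    qed
    have "?lift id = id"
      by (auto simp: a_mod)
    then have bij: "bij (?lift p)"
      using comp[of "inv_into UNIV p" p] comp[of p "inv_into UNIV p"] p permutes_inv[OF p]
      by (intro o_bij[of "?lift (inv_into UNIV p)"]) (auto simp: fun_eq_iff permutes_inv_o)
    have "?lift p (m + int s) = ?lift p m + int s" for m
      using aD(1)[of "m + int s" m] by (simp add: cong_def)
    moreover have "(\<Sum>i<s. ?lift p (int i)) = int (s choose 2)"
    proof -
      have "(\<Sum>i<s. ?lift p (int i)) = (\<Sum>i\<in>I. a (p i) + i - a i)"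
        unfolding sum_lessThan_int[of "?lift p"] by (intro sum.cong) (auto simp: I_def)
      also have "\<dots> = (\<Sum>i\<in>I. a (p i)) + (\<Sum>i\<in>I. i) - (\<Sum>i\<in>I. a i)"
        by (simp add: sum.distrib sum_subtractf)
      also have "(\<Sum>i\<in>I. a (p i)) = (\<Sum>i\<in>I. a i)"
        using sum.permute[OF p, of a] by (simp add: comp_def)
      finally show ?thesis
        by (simp add: I_def sum_int_range)
    qed
    moreover have "[?lift p m = m] (mod int t)" for m
      using pt[OF I, of m] by (simp add: cong_iff_dvd_diff a_mod)
    moreover have "?lift p ` range a = range a"
    proof (intro equalityI subsetI)
      fix y assume "y \<in> ?lift p ` range a"
      then obtain x where "y = ?lift p (a x)" by blast
      then show "y \<in> range a"
        using lift_a[OF I, of p x] by (simp add: a_mod)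
    next
      fix y assume "y \<in> range a"
      then obtain x where y: "y = a (x mod int s)"
        by (auto simp: a_mod)
      obtain i where "i \<in> I" "p i = x mod int s"
        using permutes_image[OF p] I[of x] by (metis imageE)
      then have "y = ?lift p (a i)"
        using lift_a y by simp
      then show "y \<in> ?lift p ` range a" by blast
    qed
    ultimately show "?lift p \<in> ?G"
      using bij by (simp add: core_group_def)
  qed
  show "?res ` ?G \<subseteq> ?H"
  proof (intro image_subsetI)
    fix f assume f: "f \<in> ?G"
    have "inj_on (?res f) I"
    proof (rule inj_onI)
      fix i j assume ij: "i \<in> I" "j \<in> I" "?res f i = ?res f j"
      have "f (a i) = f (a j)"
        using a_res[OF f ij(1)] a_res[OF f ij(2)] ij(3) by metis
      moreover have "inj f"
        using f by (simp add: core_group_def bij_is_inj)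
      ultimately have "a i = a j"
        by (simp add: inj_eq)
      then show "i = j"
        using mod_a I_mod ij by metis
    qed
    moreover have "?res f ` I \<subseteq> I"
      using I by auto
    ultimately have "bij_betw (?res f) I I"
      unfolding bij_betw_def using endo_inj_surj[of I "?res f"] by (simp add: I_def)
    then have "?res f permutes I"
      by (rule bij_imp_permutes) auto
    moreover have "[a (?res f i) = a i] (mod int t)" if "i \<in> I" for i
      unfolding a_res[OF f that] using f by (simp add: core_group_def)
    ultimately show "?res f \<in> ?H" by blast
  qed
qed

text \<open>Orbit-stabilizer for the symmetric group permuting the positions of the word
  \<open>r\<close>: \<open>?W\<close> is the orbit, \<open>?H\<close> the stabilizer, and each fibre
  of \<open>?\<Phi>\<close> is a coset of \<open>?H\<close>.\<close>

lemma card_permutations_preserving_mult_card_rearrangements: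
  assumes "finite A"
  shows "fact (card A) = card {p. p permutes A \<and> (\<forall>x\<in>A. r (p x) = r x)} *
    card {w \<in> extensional A. \<forall>j. card {x \<in> A. w x = j} = card {x \<in> A. r x = j}}"
    (is "_ = card ?H * card ?W")
proof -
  let ?P = "{p. p permutes A}" and ?\<Phi> = "\<lambda>p. \<lambda>x\<in>A. r (p x)"
  have fin: "finite ?P"
    using assms by (rule finite_permutations)
  have im: "?\<Phi> ` ?P = ?W"
  proof (intro equalityI subsetI)
    fix w assume "w \<in> ?\<Phi> ` ?P"
    then obtain p where p: "p permutes A" "w = ?\<Phi> p" by auto
    have "card {x \<in> A. w x = j} = card {x \<in> A. r x = j}" for j
    proof (rule bij_betw_same_card[of p], unfold bij_betw_def, intro conjI)
      show "inj_on p {x \<in> A. w x = j}"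
        using permutes_inj[OF p(1)] by (simp add: inj_on_def)
      show "p ` {x \<in> A. w x = j} = {x \<in> A. r x = j}"
      proof (intro equalityI subsetI)
        fix y assume y: "y \<in> {x \<in> A. r x = j}"
        then obtain x where "x \<in> A" "y = p x"
          using permutes_image[OF p(1)] by blast
        then show "y \<in> p ` {x \<in> A. w x = j}"
          using y p(2) by auto
      qed (use p permutes_in_image[OF p(1)] in auto)
    qed
    then show "w \<in> ?W"
      using p(2) by simp
  next
    fix w assume w: "w \<in> ?W"
    \<comment> \<open>Equal letter counts mean equal multisets of letters, and these are related by
      a permutation of positions.\<close>
    have "image_mset w (mset_set A) = image_mset r (mset_set A)"
      using w assms by (intro multiset_eqI) (simp add: count_image_mset_eq_card_vimage)
    from image_mset_eq_implies_permutes[OF assms this]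
    obtain p where p: "p permutes A" "\<forall>x\<in>A. w x = r (p x)" by blast
    then have "w = ?\<Phi> p"
      using w by (intro extensionalityI[of _ A]) auto
    then show "w \<in> ?\<Phi> ` ?P"
      using p(1) by blast
  qed
  have fiber: "card {p \<in> ?P. ?\<Phi> p = w} = card ?H" if "w \<in> ?W" for w
  proof -
    obtain q where q: "q permutes A" "w = ?\<Phi> q"
      using \<open>w \<in> ?W\<close> unfolding im[symmetric] by blast
    have "{p \<in> ?P. ?\<Phi> p = w} = (\<lambda>h. h \<circ> q) ` ?H"
    proof (intro equalityI subsetI)
      fix p assume p: "p \<in> {p \<in> ?P. ?\<Phi> p = w}"
      have eq: "r (p x) = r (q x)" if "x \<in> A" for x
        using p q(2) that by (metis (mono_tags, lifting) mem_Collect_eq restrict_apply')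
      have "p \<circ> inv_into UNIV q permutes A"
        using p permutes_inv[OF q(1)] by (auto intro: permutes_compose)
      moreover have "r ((p \<circ> inv_into UNIV q) x) = r x" if "x \<in> A" for x
        using eq[of "inv_into UNIV q x"] that permutes_in_image[OF permutes_inv[OF q(1)]] permutes_inverses[OF q(1)]
        by simp
      moreover have "p = (p \<circ> inv_into UNIV q) \<circ> q"
        using permutes_inverses[OF q(1)] by auto
      ultimately show "p \<in> (\<lambda>h. h \<circ> q) ` ?H" by blast
    next
      fix p assume "p \<in> (\<lambda>h. h \<circ> q) ` ?H"
      then obtain h where "h permutes A" "\<forall>x\<in>A. r (h x) = r x" "p = h \<circ> q" by blast
      then show "p \<in> {p \<in> ?P. ?\<Phi> p = w}"
        using q permutes_compose[OF q(1), of h] permutes_in_image[OF q(1)] by auto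
    qed
    moreover have "inj_on (\<lambda>h. h \<circ> q) ?H"
      using permutes_surj[OF q(1)] by (auto simp: inj_on_def fun_eq_iff) (metis surjD)
    ultimately show ?thesis
      by (simp add: card_image)
  qed
  have "fact (card A) = card ?P"
    using card_permutations[OF refl assms] by simp
  also have "\<dots> = (\<Sum>w\<in>?W. card {p \<in> ?P. ?\<Phi> p = w})"
    using sum.group[OF fin, of ?W ?\<Phi> "\<lambda>_. 1::nat"] im fin finite_imageI[OF fin, of ?\<Phi>] by simp
  also have "\<dots> = card ?H * card ?W"
    using fiber by simp
  finally show ?thesis .
qed

lemma card_Stab:
  assumes "s \<ge> 1" "lam \<in> cores s" "residue_reps s a" "beta_set lam = {x. x < a x}"
  shows "finite (Stab s t lam)"
    and "fact s = card (Stab s t lam) * card {w \<in> extensional {0..<int s}.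
      \<forall>j. card {i \<in> {0..<int s}. w i = j} = card {i \<in> {0..<int s}. a i mod int t = j}}"
proof -
  let ?H = "{p. p permutes {0..<int s} \<and> (\<forall>i\<in>{0..<int s}. a (p i) mod int t = a i mod int t)}"
  have bij: "bij_betw (\<lambda>p m. a (p (m mod int s)) + m - a m) ?H (Stab s t lam)"
    using bij_betw_permutations_stabilizer[OF assms(1,3), of t]
    unfolding Stab_eq[OF assms(1,2)] s_set_residue_reps[OF assms(1,3,4)] cong_def .
  have "finite {p. p permutes {0..<int s}}"
    by (rule finite_permutations) simp
  then have "finite ?H"
    by (rule rev_finite_subset) auto
  then show "finite (Stab s t lam)"
    using bij_betw_finite[OF bij] by simp
  show "fact s = card (Stab s t lam) * card {w \<in> extensional {0..<int s}.
      \<forall>j. card {i \<in> {0..<int s}. w i = j} = card {i \<in> {0..<int s}. a i mod int t = j}}"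
    using card_permutations_preserving_mult_card_rearrangements[of "{0..<int s}" "\<lambda>i. a i mod int t"]
      bij_betw_same_card[OF bij] by simp
qed

section \<open>Words and simultaneous cores\<close>

lemma coprime_periodic_const:
  fixes h :: "int \<Rightarrow> 'a"
  assumes "coprime s t" "\<And>x. h (x + int s) = h x" "\<And>x. h (x + int t) = h x"
  shows "h x = h y"
proof -
  obtain k where k: "[int s * k = 1] (mod int t)"
    using cong_solve_coprime_int[of "int s" "int t"] assms(1) by auto
  \<comment> \<open>Chinese remaindering: \<open>z\<close> is congruent to \<open>x\<close> modulo
    \<open>s\<close> and to \<open>y\<close> modulo \<open>t\<close>.\<close>
  define z where "z = x + int s * k * (y - x)"
  have "[x = z] (mod int s)"
    by (simp add: z_def cong_iff_dvd_diff)
  moreover have "[x + int s * k * (y - x) = x + 1 * (y - x)] (mod int t)"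
    by (intro cong_add cong_mult k) auto
  then have "[z = y] (mod int t)"
    by (simp add: z_def)
  ultimately show ?thesis
    using periodic_cong[of h s x z] periodic_cong[of h t z y] assms by simp
qed

section \<open>Sums over residues and over words\<close>

lemma sum_affine_mod:
  fixes h :: "int \<Rightarrow> 'a::comm_monoid_add"
  assumes "t \<ge> 1" "coprime c (int t)"
  shows "(\<Sum>j=0..<int t. h ((c * j + d) mod int t)) = (\<Sum>j=0..<int t. h j)"
proof -
  let ?f = "\<lambda>j. (c * j + d) mod int t"
  have "inj_on ?f {0..<int t}"
  proof (rule inj_onI)
    fix x y assume xy: "x \<in> {0..<int t}" "y \<in> {0..<int t}" "?f x = ?f y"
    then have "[c * x = c * y] (mod int t)"
      by (metis cong_add_rcancel cong_def)
    then have "[x = y] (mod int t)"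
      using assms(2) by (simp add: cong_mult_lcancel)
    then show "x = y"
      using xy by (simp add: cong_def)
  qed
  moreover have "?f ` {0..<int t} \<subseteq> {0..<int t}"
    using assms(1) by auto
  ultimately have "bij_betw ?f {0..<int t} {0..<int t}"
    unfolding bij_betw_def using endo_inj_surj[of "{0..<int t}" ?f] by simp
  from sum.reindex_bij_betw[OF this, of h] show ?thesis by simp
qed

text \<open>This is independence of mean zero random variables: the mixed terms vanish.\<close>

lemma sum_PiE_square:
  fixes g :: "'b \<Rightarrow> real"
  assumes "finite I" "finite A" "(\<Sum>x\<in>A. g x) = 0"
  shows "real (card A) * (\<Sum>w\<in>I \<rightarrow>\<^sub>E A. (\<Sum>i\<in>I. g (w i))\<^sup>2) =
    real (card I) * real (card A) ^ card I * (\<Sum>x\<in>A. (g x)\<^sup>2)"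
  using assms(1)
proof (induction I rule: finite_induct)
  case empty
  then show ?case by simp
next
  case (insert k F)
  let ?W = "F \<rightarrow>\<^sub>E A" and ?S = "\<lambda>w. \<Sum>i\<in>F. g (w i)"
  have upd: "(\<Sum>i\<in>F. g ((w(k := y)) i)) = ?S w" for w y
    using insert.hyps by (intro sum.cong) auto
  have "(\<Sum>w\<in>insert k F \<rightarrow>\<^sub>E A. (\<Sum>i\<in>insert k F. g (w i))\<^sup>2) =
      (\<Sum>(y, w)\<in>A \<times> ?W. (g y + ?S w)\<^sup>2)"
    unfolding PiE_insert_eq using insert.hyps upd
    by (subst sum.reindex[OF inj_combinator]) (auto simp: case_prod_unfold intro!: sum.cong)
  also have "\<dots> = (\<Sum>y\<in>A. \<Sum>w\<in>?W. (g y)\<^sup>2 + 2 * (g y * ?S w) + (?S w)\<^sup>2)"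
    by (simp add: sum.cartesian_product power2_sum algebra_simps)
  also have "\<dots> = (\<Sum>y\<in>A. \<Sum>w\<in>?W. (g y)\<^sup>2) + 2 * (\<Sum>y\<in>A. \<Sum>w\<in>?W. g y * ?S w)
      + (\<Sum>y\<in>A. \<Sum>w\<in>?W. (?S w)\<^sup>2)"
    by (simp only: sum.distrib sum_distrib_left)
  also have "\<dots> = real (card ?W) * (\<Sum>y\<in>A. (g y)\<^sup>2) + real (card A) * (\<Sum>w\<in>?W. (?S w)\<^sup>2)"
    unfolding sum_product[symmetric] by (simp add: assms(3) sum_distrib_left)
  finally show ?case
    using insert by (simp add: card_PiE algebra_simps)
qed

text \<open>Split all words by letter sum modulo \<open>t\<close>. Raising every letter by 1 carries
  the class of \<open>c\<close> onto that of \<open>c + s\<close> and preserves \<open>Q\<close>, so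
  the partial sums have periods \<open>s\<close> and \<open>t\<close> and all \<open>t\<close> of
  them agree.\<close>

lemma sum_words_shift_invariant:
  fixes Q :: "(int \<Rightarrow> int) \<Rightarrow> real"
  assumes "t \<ge> 1" "coprime s t"
    and Q: "\<And>w. Q (\<lambda>i\<in>{0..<int s}. (w i + 1) mod int t) = Q w"
  shows "(\<Sum>w\<in>{0..<int s} \<rightarrow>\<^sub>E {0..<int t}. Q w) =
    real t * (\<Sum>w\<in>{w \<in> {0..<int s} \<rightarrow>\<^sub>E {0..<int t}. [\<Sum>i=0..<int s. w i = c] (mod int t)}. Q w)"
proof -
  let ?I = "{0..<int s}" and ?T = "{0..<int t}"
  let ?W = "\<lambda>c. {w \<in> ?I \<rightarrow>\<^sub>E ?T. [\<Sum>i\<in>?I. w i = c] (mod int t)}"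
  let ?shift = "\<lambda>d w. \<lambda>i\<in>?I. (w i + d) mod int t"
  define F where "F c = (\<Sum>w\<in>?W c. Q w)" for c
  have shift_in: "?shift d w \<in> ?W (c + d * int s)" if "w \<in> ?W c" for w c d
  proof -
    have "[\<Sum>i\<in>?I. ?shift d w i = \<Sum>i\<in>?I. w i + d] (mod int t)"
      by (intro cong_sum) (auto simp: cong_def)
    also have "(\<Sum>i\<in>?I. w i + d) = (\<Sum>i\<in>?I. w i) + d * int s"
      by (simp add: sum.distrib)
    also have "[\<dots> = c + d * int s] (mod int t)"
      using that by (intro cong_add) auto
    finally show ?thesis
      using assms(1) by auto
  qed
  have shift_shift: "?shift (- d) (?shift d w) = w" if "w \<in> ?W c" for w c d
  proof (rule extensionalityI[of _ ?I])
    fix i assume i: "i \<in> ?I"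
    then have "w i mod int t = w i"
      using that PiE_mem[of w ?I "\<lambda>_. ?T" i] by simp
    with i show "?shift (- d) (?shift d w) i = w i"
      by (simp add: mod_diff_left_eq)
  qed (use that in \<open>auto simp: PiE_def\<close>)
  have "F (c + int s) = F c" for c
    unfolding F_def
  proof (rule sum.reindex_bij_witness[of _ "?shift 1" "?shift (- 1)"])
    fix w assume w: "w \<in> ?W (c + int s)"
    show "?shift (- 1) w \<in> ?W c"
      using shift_in[OF w, of "- 1"] by simp
    show "?shift 1 (?shift (- 1) w) = w"
      using shift_shift[OF w, of "- 1"] by simp
    then show "Q (?shift (- 1) w) = Q w"
      using Q[of "?shift (- 1) w"] by simp
  next
    fix w assume w: "w \<in> ?W c"
    show "?shift 1 w \<in> ?W (c + int s)"
      using shift_in[OF w, of 1] by simp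
    show "?shift (- 1) (?shift 1 w) = w"
      by (rule shift_shift[OF w])
  qed
  moreover have "F (c + int t) = F c" for c
    by (simp add: F_def cong_def)
  ultimately have F: "F c' = F c" for c'
    by (rule coprime_periodic_const[OF assms(2)])
  have fin: "finite (?I \<rightarrow>\<^sub>E ?T)"
    by (intro finite_PiE) auto
  have "(\<Sum>w\<in>?I \<rightarrow>\<^sub>E ?T. Q w) =
      (\<Sum>c\<in>?T. \<Sum>w\<in>{w \<in> ?I \<rightarrow>\<^sub>E ?T. (\<Sum>i\<in>?I. w i) mod int t = c}. Q w)"
    using assms(1) fin by (intro sum.group[symmetric]) auto
  also have "\<dots> = (\<Sum>c\<in>?T. F c)"
    unfolding F_def by (intro sum.cong) (auto simp: cong_def)
  also have "\<dots> = (\<Sum>c'\<in>?T. F c)"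
    by (intro sum.cong refl F)
  finally show ?thesis
    by (simp add: F_def)
qed

section \<open>The simultaneous core attached to a word\<close>

locale coprime_pair =
  fixes s t :: nat and u :: int
  assumes s: "s \<ge> 1" and t: "t \<ge> 1" and coprime: "coprime s t"
    and u: "[int s * u = 1] (mod int t)"
begin

abbreviation "I \<equiv> {0..<int s}"
abbreviation "T \<equiv> {0..<int t}"

definition "words = {w \<in> I \<rightarrow>\<^sub>E T. [\<Sum>i\<in>I. w i = int (s choose 2)] (mod int t)}"

text \<open>The residue representatives of the simultaneous core attached to a word: up to centering, a sum of
  independent terms, one for each letter.\<close>

definition word_reps :: "(int \<Rightarrow> int) \<Rightarrow> int \<Rightarrow> int" where
  "word_reps w j = (\<Sum>i\<in>I. ((j - w i) * u) mod int t) - (int s - 1) * (int t - 1) div 2"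

text \<open>Coprime numbers are not both even, so the offset in \<open>word_reps\<close> is an exact
  half: \<open>s - 1\<close> times the mean \<open>(t - 1) / 2\<close> of a residue.\<close>

lemma two_offset: "2 * ((int s - 1) * (int t - 1) div 2) = (int s - 1) * (int t - 1)"
proof -
  have "odd s \<or> odd t"
    using coprime by (metis coprime_common_divisor odd_one even_numeral dvd_refl)
  then show ?thesis
    by (intro dvd_mult_div_cancel) auto
qed

lemma coprime_int: "coprime (int s) (int t)" "coprime u (int t)"
proof -
  show "coprime (int s) (int t)"
    using coprime by simp
  have "coprime (int s * u) (int t)"
    using cong_imp_coprime[OF cong_sym[OF u]] by simp
  then show "coprime u (int t)" by simp
qed

lemma word_reps_cong:
  assumes "[x = y] (mod int t)"
  shows "word_reps w x = word_reps w y"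
proof -
  have "((x - w i) * u) mod int t = ((y - w i) * u) mod int t" for i
    using cong_mult[OF cong_diff[OF assms cong_refl] cong_refl] unfolding cong_def .
  then show ?thesis
    by (simp add: word_reps_def)
qed

text \<open>Multiplication by \<open>u\<close> turns a step of length \<open>s\<close> into a unit
  step. So passing from \<open>j - s\<close> to \<open>j\<close> raises each residue by 1, except
  that it wraps from \<open>t - 1\<close> to 0 for the letters equal to \<open>j\<close> modulo
  \<open>t\<close>.\<close>

lemma word_reps_step:
  assumes "w \<in> I \<rightarrow>\<^sub>E T"
  shows "word_reps w j - word_reps w (j - int s) =
    int s - int t * int (card {i \<in> I. w i = j mod int t})"
proof -
  have summand: "((j - w i) * u) mod int t - ((j - int s - w i) * u) mod int t =
      1 - (if w i = j mod int t then int t else 0)" if "i \<in> I" for i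
  proof -
    define x where "x = (j - w i) * u"
    have "[(j - int s - w i) * u = x - int s * u] (mod int t)"
      by (simp add: x_def algebra_simps)
    also have "[x - int s * u = x - 1] (mod int t)"
      by (intro cong_diff u) auto
    finally have "((j - int s - w i) * u) mod int t = (x - 1) mod int t"
      by (simp add: cong_def)
    moreover have "x mod int t - (x - 1) mod int t = 1 - (if x mod int t = 0 then int t else 0)"
    proof (cases "x mod int t = 0")
      case True
      then have "(x - 1) mod int t = (- 1) mod int t"
        by (metis diff_0 mod_diff_left_eq)
      then show ?thesis
        using True t by (simp add: zmod_minus1)
    next
      case False
      have "(x - 1) mod int t = (x mod int t - 1) mod int t"
        by (simp add: mod_diff_left_eq)
      also have "\<dots> = x mod int t - 1"
      proof (rule mod_pos_pos_trivial)
        show "0 \<le> x mod int t - 1" "x mod int t - 1 < int t"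
          using False t pos_mod_sign[of "int t" x] pos_mod_bound[of "int t" x] by linarith+
      qed
      finally show ?thesis
        using False by simp
    qed
    moreover have "x mod int t = 0 \<longleftrightarrow> w i = j mod int t"
    proof -
      have "w i mod int t = w i"
        using PiE_mem[OF assms that] by simp
      moreover have "x mod int t = 0 \<longleftrightarrow> int t dvd j - w i"
        using coprime_int(2)
        by (simp add: x_def mod_eq_0_iff_dvd coprime_commute coprime_dvd_mult_left_iff)
      ultimately show ?thesis
        by (metis mod_eq_dvd_iff)
    qed
    ultimately show ?thesis
      by (simp add: x_def)
  qed
  have "word_reps w j - word_reps w (j - int s) =
      (\<Sum>i\<in>I. 1 - (if w i = j mod int t then int t else 0))"
    using summand by (simp add: word_reps_def sum_subtractf[symmetric] del: of_nat_diff)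
  also have "\<dots> = int s - int t * int (card {i \<in> I. w i = j mod int t})"
    by (simp add: sum_subtractf sum.inter_filter[symmetric])
  finally show ?thesis .
qed

lemma sum_residues: "(\<Sum>j\<in>T. h (((j - c) * u) mod int t)) = (\<Sum>j\<in>T. h j)"
  using sum_affine_mod[OF t coprime_int(2), of h "- c * u"] by (simp add: algebra_simps)

lemma sum_residues': "(\<Sum>j\<in>T. h (((c - j) * u) mod int t)) = (\<Sum>j\<in>T. h j)"
  using sum_affine_mod[OF t, of "- u" h "c * u"] coprime_int(2) by (simp add: algebra_simps)

text \<open>For each letter the residues run through all of \<open>T\<close> as \<open>j\<close>
  does; the offset is chosen to bring the total to \<open>t choose 2\<close>.\<close>

lemma sum_word_reps: "(\<Sum>j\<in>T. word_reps w j) = int (t choose 2)"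
proof -
  have "(\<Sum>j\<in>T. word_reps w j) =
      (\<Sum>i\<in>I. \<Sum>j\<in>T. ((j - w i) * u) mod int t) - int t * ((int s - 1) * (int t - 1) div 2)"
    by (simp add: word_reps_def sum_subtractf sum.swap[of _ I T])
  also have "\<dots> = int s * int (t choose 2) - int t * ((int s - 1) * (int t - 1) div 2)"
    using sum_residues[of "\<lambda>x. x"] by (simp add: sum_int_range)
  finally have "2 * (\<Sum>j\<in>T. word_reps w j) =
      int s * (2 * int (t choose 2)) - int t * (2 * ((int s - 1) * (int t - 1) div 2))"
    by (simp add: algebra_simps)
  also have "\<dots> = 2 * int (t choose 2)"
    unfolding two_choose_two two_offset by (simp add: algebra_simps)
  finally show ?thesis by simp
qed

text \<open>Modulo \<open>t\<close>, \<open>word_reps w j\<close> is \<open>j - (u * C + E)\<close>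
  by the constraint on the letter sum. The constant vanishes because \<open>s\<close> times it is
  \<open>C + s * E = C * t\<close>, and \<open>s\<close> is invertible.\<close>

lemma residue_reps_word_reps:
  assumes "w \<in> words"
  shows "residue_reps t (word_reps w)"
proof -
  define E where "E = (int s - 1) * (int t - 1) div 2"
  define C where "C = int (s choose 2)"
  have C2: "2 * C = int s * (int s - 1)" and E2: "2 * E = (int s - 1) * (int t - 1)"
    unfolding C_def E_def by (rule two_choose_two two_offset)+
  have "2 * (C + int s * E) = 2 * C + int s * (2 * E)"
    by simp
  also have "\<dots> = int s * (int s - 1) * int t"
    unfolding C2 E2 by (simp add: algebra_simps)
  also have "\<dots> = 2 * (C * int t)"
    unfolding C2[symmetric] by simp
  finally have CE: "C + int s * E = C * int t" by simp
  have "[int s * u * C + int s * E = 1 * C + int s * E] (mod int t)"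
    by (intro cong_add cong_mult u cong_refl)
  also have "1 * C + int s * E = C * int t"
    using CE by simp
  also have "[C * int t = 0] (mod int t)"
    by (simp add: cong_0_iff)
  finally have "int t dvd int s * (u * C + E)"
    by (simp add: cong_0_iff algebra_simps)
  then have E: "[u * C + E = 0] (mod int t)"
    using coprime_int(1) by (simp add: cong_0_iff coprime_commute coprime_dvd_mult_right_iff)
  have "[word_reps w j = j] (mod int t)" for j
  proof -
    have "[\<Sum>i\<in>I. ((j - w i) * u) mod int t = \<Sum>i\<in>I. (j - w i) * u] (mod int t)"
      by (intro cong_sum) (auto simp: cong_def)
    then have "[word_reps w j = (\<Sum>i\<in>I. (j - w i) * u) - E] (mod int t)"
      unfolding word_reps_def E_def by (intro cong_diff) auto
    also have "(\<Sum>i\<in>I. (j - w i) * u) - E = int s * u * j - (u * (\<Sum>i\<in>I. w i) + E)"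
      by (simp add: left_diff_distrib sum_subtractf sum_distrib_left algebra_simps)
    also have "[\<dots> = 1 * j - (u * C + E)] (mod int t)"
      using assms by (intro cong_diff cong_add cong_mult u) (auto simp: words_def C_def)
    also have "[1 * j - (u * C + E) = 1 * j - 0] (mod int t)"
      by (intro cong_diff E) auto
    finally show ?thesis by simp
  qed
  then show ?thesis
    using word_reps_cong sum_word_reps by (simp add: residue_reps_def)
qed

definition word_core :: "(int \<Rightarrow> int) \<Rightarrow> nat \<Rightarrow> nat" where
  "word_core w = (THE lam. partition lam \<and> beta_set lam = {x. x < word_reps w x})"

lemma word_core_eqI:
  assumes "partition lam" "beta_set lam = {x. x < word_reps w x}"
  shows "word_core w = lam"
  unfolding word_core_def
proof (rule the_equality)
  show "nu = lam" if "partition nu \<and> beta_set nu = {x. x < word_reps w x}" for nu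
    using beta_set_inject[of nu lam] that assms by simp
qed (simp add: assms)

text \<open>Being a \<open>t\<close>-core comes from the representatives. Being an
  \<open>s\<close>-core comes from \<open>word_reps_step\<close>: the letter count there is
  nonnegative, so a step back by \<open>s\<close> lowers \<open>word_reps w\<close> by at most
  \<open>s\<close>.\<close>

lemma word_core:
  assumes "w \<in> words"
  shows "word_core w \<in> cores s \<inter> cores t" "beta_set (word_core w) = {x. x < word_reps w x}"
proof -
  obtain lam where lam: "lam \<in> cores t" "beta_set lam = {x. x < word_reps w x}"
    using core_of_residue_reps[OF t residue_reps_word_reps[OF assms]] by blast
  have part: "partition lam"
    using lam by (simp add: cores_def)
  have "word_reps w x - int s \<le> word_reps w (x - int s)" for x
  proof -
    have "0 \<le> int t * int (card {i \<in> I. w i = x mod int t})"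
      by simp
    moreover have "w \<in> I \<rightarrow>\<^sub>E T"
      using assms by (simp add: words_def)
    ultimately show ?thesis
      using word_reps_step[of w x] by linarith
  qed
  then have "x - int s < word_reps w (x - int s)" if "x < word_reps w x" for x
    using that by (smt (verit))
  then have "lam \<in> cores s"
    using part lam(2) s by (simp add: cores_iff)
  then show "word_core w \<in> cores s \<inter> cores t" "beta_set (word_core w) = {x. x < word_reps w x}"
    using word_core_eqI[OF part lam(2)] lam by auto
qed

text \<open>The members of the \<open>s\<close>-set in the class of \<open>j\<close> modulo
  \<open>t\<close> form the progression \<open>b j\<close>, \<open>b j + t\<close>, ... that stops
  before \<open>b (j - s) + s\<close>; its length is the \<open>k\<close> of the proof.\<close>

lemma card_reps_residue:
  assumes lam: "lam \<in> cores s"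
    and a: "residue_reps s a" "beta_set lam = {x. x < a x}"
    and b: "residue_reps t b" "beta_set lam = {x. x < b x}"
  shows "b j - b (j - int s) = int s - int t * int (card {i \<in> I. a i mod int t = j mod int t})"
proof -
  have t0: "int t > 0" using t by simp
  have "[b j - b (j - int s) = j - (j - int s)] (mod int t)"
    by (intro cong_diff residue_repsD(2)[OF b(1)])
  then have "int t dvd int s - (b j - b (j - int s))"
    by (simp add: cong_iff_dvd_diff dvd_diff_commute)
  then obtain k where k: "int s - (b j - b (j - int s)) = int t * k" ..
  \<comment> \<open>\<open>b j - t\<close> is in the beta-set, hence so is
    \<open>b j - t - s\<close> for an \<open>s\<close>-core. This gives
    \<open>t * (k + 1) > 0\<close>, enough for an integer \<open>k\<close>.\<close>
  have "k \<ge> 0"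
  proof -
    have "b (b j - int t) = b j"
      by (rule residue_repsD(1)[OF b(1)]) (use residue_repsD(2)[OF b(1), of j] in \<open>simp add: cong_def\<close>)
    then have "b j - int t \<in> beta_set lam"
      using b(2) t0 by simp
    then have "b j - int t - int s \<in> beta_set lam"
      using lam s cores_iff by blast
    then have "b j - int t - int s < b (b j - int t - int s)"
      using b(2) by simp
    also have "b (b j - int t - int s) = b (j - int s)"
    proof (rule residue_repsD(1)[OF b(1)])
      have "[b j - int t - int s = j - 0 - int s] (mod int t)"
        by (intro cong_diff residue_repsD(2)[OF b(1)] cong_refl) (simp add: cong_0_iff)
      then show "[b j - int t - int s = j - int s] (mod int t)"
        by simp
    qed
    finally have "int t * (k + 1) > 0"
      using k by (simp add: algebra_simps)
    then show ?thesis
      using t0 by (simp add: zero_less_mult_iff)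
  qed
  have "{y \<in> range a. y mod int t = j mod int t} = (\<lambda>l. b j + int t * l) ` {0..<k}"
  proof (intro equalityI subsetI)
    fix y assume "y \<in> {y \<in> range a. y mod int t = j mod int t}"
    then have y: "y \<in> s_set s lam" "[y = j] (mod int t)"
      using s_set_residue_reps[OF s a] by (auto simp: cong_def)
    then have "y - int s < b (y - int s)" "b y \<le> y"
      unfolding s_set_def b(2) by auto
    moreover have "b y = b j" "b (y - int s) = b (j - int s)"
      using y(2) by (auto intro!: residue_repsD(1)[OF b(1)] cong_diff)
    ultimately have *: "y - int s < b (j - int s)" "b j \<le> y" by auto
    have "[y = b j] (mod int t)"
      using y(2) residue_repsD(2)[OF b(1), of j] cong_sym cong_trans by blast
    then obtain l where l: "y - b j = int t * l"
      by (auto simp: cong_iff_dvd_diff)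
    then have "int t * l < int t * k" "int t * l \<ge> 0"
      using * k by auto
    then have "l \<in> {0..<k}"
      using t0 by (auto simp: zero_le_mult_iff)
    then show "y \<in> (\<lambda>l. b j + int t * l) ` {0..<k}"
      using l by (intro image_eqI[of _ _ l]) auto
  next
    fix y assume "y \<in> (\<lambda>l. b j + int t * l) ` {0..<k}"
    then obtain l where l: "0 \<le> l" "l < k" "y = b j + int t * l" by auto
    have y: "[y = j] (mod int t)"
      using residue_repsD(2)[OF b(1), of j] l by (simp add: cong_def)
    have "b y = b j" "b (y - int s) = b (j - int s)"
      using y by (auto intro!: residue_repsD(1)[OF b(1)] cong_diff)
    moreover have "int t * l \<ge> 0" "int t * l < int t * k"
      using l t0 by simp_all
    ultimately have "b y \<le> y" "y - int s < b (y - int s)"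
      using l k by simp_all
    then have "y \<in> s_set s lam"
      unfolding s_set_def b(2) by (auto simp: image_iff intro!: exI[of _ "y - int s"])
    then show "y \<in> {y \<in> range a. y mod int t = j mod int t}"
      using y s_set_residue_reps[OF s a] by (simp add: cong_def)
  qed
  also have "card \<dots> = nat k"
    using t0 by (subst card_image) (auto simp: inj_on_def)
  finally have "card {y \<in> range a. y mod int t = j mod int t} = nat k" .
  moreover have bij: "bij_betw a I (range a)"
    by (rule bij_betw_residues[OF s residue_repsD(1,2)[OF a(1)]])
  moreover have "bij_betw a {i \<in> I. a i mod int t = j mod int t} {y \<in> range a. y mod int t = j mod int t}"
  proof (rule bij_betw_subset[OF bij])
    show "a ` {i \<in> I. a i mod int t = j mod int t} = {y \<in> range a. y mod int t = j mod int t}"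
      unfolding bij_betw_imp_surj_on[OF bij, symmetric] by auto
  qed auto
  note bij_betw_same_card[OF this]
  ultimately have "card {i \<in> I. a i mod int t = j mod int t} = nat k"
    by (simp only:)
  then show ?thesis
    using k \<open>k \<ge> 0\<close> by simp
qed

text \<open>The letter counts of \<open>w\<close> and the residue counts of the \<open>s\<close>-set
  govern the same differences of \<open>t\<close>-representatives, by \<open>word_reps_step\<close>
  and \<open>card_reps_residue\<close>. Equal counts thus make the two families of representatives
  agree up to a constant.\<close>

lemma word_core_fiber:
  assumes lam: "lam \<in> cores s \<inter> cores t"
    and a: "residue_reps s a" "beta_set lam = {x. x < a x}"
  shows "{w \<in> words. word_core w = lam} = {w \<in> extensional I.
    \<forall>j. card {i \<in> I. w i = j} = card {i \<in> I. a i mod int t = j}}"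
proof -
  obtain b where b: "residue_reps t b" "beta_set lam = {x. x < b x}"
    using residue_reps_of_core[OF t, of lam] lam by blast
  have count: "b j - b (j - int s) = int s - int t * int (card {i \<in> I. a i mod int t = j mod int t})" for j
    using card_reps_residue lam a b by blast
  show ?thesis
  proof (intro equalityI subsetI)
    fix w assume "w \<in> {w \<in> words. word_core w = lam}"
    then have w: "w \<in> words" "word_core w = lam" by auto
    then have PiE: "w \<in> I \<rightarrow>\<^sub>E T" by (simp add: words_def)
    note reps = residue_reps_word_reps[OF w(1)]
    have "range (word_reps w) = range b"
      using s_set_residue_reps[OF t reps word_core(2)[OF w(1)]] s_set_residue_reps[OF t b] w(2) by simp
    then have eq: "word_reps w = b"
      by (rule residue_reps_eqI[OF reps b(1)])
    have "card {i \<in> I. w i = j} = card {i \<in> I. a i mod int t = j}" for j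
    proof (cases "j \<in> T")
      case True
      then show ?thesis
        using word_reps_step[OF PiE, of j] count[of j] eq t by simp
    next
      case False
      then have "{i \<in> I. w i = j} = {}" "{i \<in> I. a i mod int t = j} = {}"
        using PiE t by auto
      then show ?thesis by (simp only:)
    qed
    then show "w \<in> {w \<in> extensional I.
        \<forall>j. card {i \<in> I. w i = j} = card {i \<in> I. a i mod int t = j}}"
      using PiE by (simp add: PiE_def)
  next
    fix w assume "w \<in> {w \<in> extensional I.
        \<forall>j. card {i \<in> I. w i = j} = card {i \<in> I. a i mod int t = j}}"
    then have ext: "w \<in> extensional I"
      and w: "\<And>j. card {i \<in> I. w i = j} = card {i \<in> I. a i mod int t = j}" by auto
    have "w i \<in> T" if "i \<in> I" for i
    proof -
      have "finite {i' \<in> I. w i' = w i}"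
        by (rule finite_subset[of _ I]) auto
      then have "card {i' \<in> I. w i' = w i} \<noteq> 0"
        using that by (subst card_0_eq) auto
      then have "{i' \<in> I. a i' mod int t = w i} \<noteq> {}"
        unfolding w by (metis card.empty)
      then obtain i' where "a i' mod int t = w i" by blast
      from this[symmetric] show ?thesis
        using t by simp
    qed
    then have PiE: "w \<in> I \<rightarrow>\<^sub>E T"
      using ext by (simp add: PiE_def)
    have sum_eq: "(\<Sum>i\<in>I. v i) = (\<Sum>j\<in>T. int (card {i \<in> I. v i = j}) * j)" if "v ` I \<subseteq> T"
      for v :: "int \<Rightarrow> int"
    proof -
      have "(\<Sum>i\<in>I. v i) = (\<Sum>j\<in>T. \<Sum>i\<in>{i \<in> I. v i = j}. v i)"
        using that by (intro sum.group[symmetric]) auto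
      also have "\<dots> = (\<Sum>j\<in>T. \<Sum>i\<in>{i \<in> I. v i = j}. j)"
        by (intro sum.cong refl) auto
      finally show ?thesis by simp
    qed
    \<comment> \<open>A letter sum depends only on the letter counts, so \<open>w\<close> inherits
      the constraint from the sum of the \<open>s\<close>-set.\<close>
    have "(\<Sum>i\<in>I. w i) = (\<Sum>i\<in>I. a i mod int t)"
    proof -
      have "w ` I \<subseteq> T" "(\<lambda>i. a i mod int t) ` I \<subseteq> T"
        using PiE_mem[OF PiE] t by auto
      then show ?thesis
        by (simp only: sum_eq w)
    qed
    also have "[\<dots> = \<Sum>i\<in>I. a i] (mod int t)"
      by (intro cong_sum) (auto simp: cong_def)
    finally have words: "w \<in> words"
      using PiE residue_repsD(3)[OF a(1)] by (simp add: words_def)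
    \<comment> \<open>\<open>d\<close> has the coprime periods \<open>s\<close> and
      \<open>t\<close>, hence is constant; it is 0 because both families sum to
      \<open>t choose 2\<close> over \<open>T\<close>.\<close>
    define d where "d x = word_reps w x - b x" for x
    have "d (x + int s) = d x" for x
      using word_reps_step[OF PiE, of "x + int s"] count[of "x + int s"] w by (simp add: d_def)
    moreover have "d (x + int t) = d x" for x
      using word_reps_cong[of "x + int t" x w] residue_repsD(1)[OF b(1), of "x + int t" x]
      by (simp add: d_def cong_def)
    ultimately have "d x = d y" for x y
      by (rule coprime_periodic_const[OF coprime])
    then have d: "d x = d 0" for x .
    have "(\<Sum>x\<in>T. d x) = 0"
      using sum_word_reps[of w] residue_repsD(3)[OF b(1)] by (simp add: d_def sum_subtractf)
    moreover have "(\<Sum>x\<in>T. d x) = int t * d 0"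
      by (subst d) simp
    ultimately have "d 0 = 0"
      using t by simp
    then have "word_reps w = b"
      using d by (simp add: d_def fun_eq_iff)
    then have "word_core w = lam"
      using word_core_eqI[of lam w] b(2) lam by (auto simp: cores_def)
    with words show "w \<in> {w \<in> words. word_core w = lam}" by simp
  qed
qed

section \<open>Weighted sums over cores as sums over words\<close>

lemma finite_words: "finite words"
proof -
  have "finite (I \<rightarrow>\<^sub>E T)"
    by (intro finite_PiE) auto
  then show ?thesis
    by (simp add: words_def)
qed

lemma card_word_core_fiber:
  assumes "lam \<in> cores s \<inter> cores t"
  shows "finite (Stab s t lam)"
    and "fact s = card (Stab s t lam) * card {w \<in> words. word_core w = lam}"
proof -
  obtain a where a: "residue_reps s a" "beta_set lam = {x. x < a x}"
    using residue_reps_of_core[OF s, of lam] assms by blast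
  show "finite (Stab s t lam)"
    and "fact s = card (Stab s t lam) * card {w \<in> words. word_core w = lam}"
    using card_Stab[OF s _ a, of t] assms word_core_fiber[OF assms a] by auto
qed

text \<open>Since \<open>fact s\<close> is nonzero, no fibre of \<open>word_core\<close> over a
  simultaneous core is empty, so the finitely many words reach all of them.\<close>

lemma finite_simultaneous_cores: "finite (cores s \<inter> cores t)"
proof (rule finite_subset[OF _ finite_imageI[OF finite_words]])
  show "cores s \<inter> cores t \<subseteq> word_core ` words"
  proof
    fix lam assume lam: "lam \<in> cores s \<inter> cores t"
    have "card (Stab s t lam) * card {w \<in> words. word_core w = lam} \<noteq> 0"
      using card_word_core_fiber(2)[OF lam] by (metis fact_nonzero)
    then have "{w \<in> words. word_core w = lam} \<noteq> {}"
      by (metis card.empty mult_0_right)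
    then show "lam \<in> word_core ` words" by blast
  qed
qed

text \<open>Group the words by their core: each fibre has \<open>fact s\<close> divided by the
  stabilizer order many words.\<close>

lemma weighted_sum_cores:
  fixes F :: "(nat \<Rightarrow> nat) \<Rightarrow> real"
  shows "(\<Sum>lam\<in>cores s \<inter> cores t. inverse (real (card (Stab s t lam))) * F lam) =
    (\<Sum>w\<in>words. F (word_core w)) / fact s"
proof -
  have "(\<Sum>w\<in>words. F (word_core w)) =
      (\<Sum>lam\<in>cores s \<inter> cores t. \<Sum>w\<in>{w \<in> words. word_core w = lam}. F (word_core w))"
    using word_core(1) by (intro sum.group[symmetric] finite_words finite_simultaneous_cores) auto
  also have "\<dots> = (\<Sum>lam\<in>cores s \<inter> cores t. fact s * (inverse (real (card (Stab s t lam))) * F lam))"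
  proof (intro sum.cong refl)
    fix lam assume lam: "lam \<in> cores s \<inter> cores t"
    have "real (fact s) = real (card (Stab s t lam)) * real (card {w \<in> words. word_core w = lam})"
      using card_word_core_fiber(2)[OF lam] by (metis of_nat_mult)
    moreover have "real (card (Stab s t lam)) \<noteq> 0"
      using calculation by (metis fact_nonzero mult_zero_left of_nat_fact)
    ultimately show "(\<Sum>w\<in>{w \<in> words. word_core w = lam}. F (word_core w)) =
        fact s * (inverse (real (card (Stab s t lam))) * F lam)"
      by (simp add: field_simps)
  qed
  finally show ?thesis
    by (simp add: sum_distrib_left[symmetric])
qed

section \<open>Moments of the representatives of a random word\<close>

lemma word_reps_shift:
  "word_reps (\<lambda>i\<in>I. (w i + 1) mod int t) j = word_reps w (j - 1)"
proof -
  have "((j - (w i + 1) mod int t) * u) mod int t = ((j - 1 - w i) * u) mod int t" for i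
  proof -
    have "[(j - (w i + 1) mod int t) * u = (j - (w i + 1)) * u] (mod int t)"
      by (intro cong_mult cong_diff) (auto simp: cong_def)
    then show ?thesis
      by (simp add: cong_def algebra_simps)
  qed
  then show ?thesis
    by (simp add: word_reps_def)
qed

text \<open>Shifting all letters only translates \<open>j\<close>, which the sum over the full set
  \<open>T\<close> does not notice; so the constraint on the letter sum can be lifted.\<close>

lemma sum_words_word_reps_square:
  "real t * (\<Sum>w\<in>words. \<Sum>j\<in>T. (real_of_int (word_reps w j))\<^sup>2) =
    (\<Sum>w\<in>I \<rightarrow>\<^sub>E T. \<Sum>j\<in>T. (real_of_int (word_reps w j))\<^sup>2)"
  unfolding words_def
proof (rule sum_words_shift_invariant[OF t coprime, symmetric])
  fix w
  have "(\<Sum>j\<in>T. (real_of_int (word_reps (\<lambda>i\<in>I. (w i + 1) mod int t) j))\<^sup>2) =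
      (\<Sum>j\<in>T. (real_of_int (word_reps w ((1 * j + - 1) mod int t)))\<^sup>2)"
    unfolding word_reps_shift
    by (intro sum.cong refl arg_cong[where f = "\<lambda>x. (real_of_int x)\<^sup>2"] word_reps_cong)
      (simp add: cong_def)
  also have "\<dots> = (\<Sum>j\<in>T. (real_of_int (word_reps w j))\<^sup>2)"
    by (rule sum_affine_mod[OF t]) simp
  finally show "(\<Sum>j\<in>T. (real_of_int (word_reps (\<lambda>i\<in>I. (w i + 1) mod int t) j))\<^sup>2) =
      (\<Sum>j\<in>T. (real_of_int (word_reps w j))\<^sup>2)" .
qed

lemma card_words: "real t * real (card words) = real t ^ s"
  using sum_words_shift_invariant[OF t coprime, of "\<lambda>_. 1" "int (s choose 2)"]
  by (simp add: words_def card_PiE)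

lemma sum_T_real: "(\<Sum>j\<in>T. real_of_int j) = real t * (real t - 1) / 2"
proof -
  have "(\<Sum>j\<in>T. real_of_int j) = (\<Sum>i<t. real i)"
    by (rule sum.reindex_bij_witness[of _ int nat]) auto
  also have "\<dots> = real t * (real t - 1) / 2"
    by (induction t) (auto simp: field_simps)
  finally show ?thesis .
qed

lemma sum_T_square: "(\<Sum>j\<in>T. (real_of_int j)\<^sup>2) = real t * (real t - 1) * (2 * real t - 1) / 6"
proof -
  have "(\<Sum>j\<in>T. (real_of_int j)\<^sup>2) = (\<Sum>i<t. (real i)\<^sup>2)"
    by (rule sum.reindex_bij_witness[of _ int nat]) auto
  also have "\<dots> = real t * (real t - 1) * (2 * real t - 1) / 6"
    by (induction t) (auto simp: field_simps power2_eq_square)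
  finally show ?thesis .
qed

text \<open>Centering each residue at its mean \<open>m\<close> leaves independent terms of mean
  zero and variance \<open>(t^2 - 1) / 12\<close>; there are \<open>s\<close> of them.\<close>

lemma second_moment_word_reps:
  "(\<Sum>w\<in>I \<rightarrow>\<^sub>E T. \<Sum>j\<in>T. (real_of_int (word_reps w j))\<^sup>2) =
    real t ^ s * (real s * real t * ((real t)\<^sup>2 - 1) / 12 + real t * (real t - 1)\<^sup>2 / 4)"
proof -
  define m where "m = (real t - 1) / 2"
  define g where "g j x = real_of_int (((j - x) * u) mod int t) - m" for j x
  have t0: "real t \<noteq> 0" using t by simp
  have "(\<Sum>x\<in>T. g j x) = (\<Sum>k\<in>T. real_of_int k - m)" for j
    unfolding g_def by (rule sum_residues')
  then have g0: "(\<Sum>x\<in>T. g j x) = 0" for j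
    by (simp add: sum_subtractf sum_T_real m_def)
  have "(\<Sum>x\<in>T. (g j x)\<^sup>2) = (\<Sum>k\<in>T. (real_of_int k - m)\<^sup>2)" for j
    unfolding g_def by (rule sum_residues')
  also have "(\<Sum>k\<in>T. (real_of_int k - m)\<^sup>2) =
      (\<Sum>k\<in>T. (real_of_int k)\<^sup>2) - 2 * m * (\<Sum>k\<in>T. real_of_int k) + real t * m\<^sup>2"
    by (simp add: power2_diff sum.distrib sum_subtractf sum_distrib_left algebra_simps)
  also have "\<dots> = real t * ((real t)\<^sup>2 - 1) / 12"
    unfolding sum_T_real sum_T_square m_def by (simp add: field_simps power2_eq_square)
  finally have g2: "(\<Sum>x\<in>T. (g j x)\<^sup>2) = real t * ((real t)\<^sup>2 - 1) / 12" for j .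
  have "real t * (\<Sum>w\<in>I \<rightarrow>\<^sub>E T. (\<Sum>i\<in>I. g j (w i))\<^sup>2) =
      real t * (real s * real t ^ s * ((real t)\<^sup>2 - 1) / 12)" for j
    using sum_PiE_square[of I T "g j"] g0 g2 by simp
  then have moment: "(\<Sum>w\<in>I \<rightarrow>\<^sub>E T. (\<Sum>i\<in>I. g j (w i))\<^sup>2) =
      real s * real t ^ s * ((real t)\<^sup>2 - 1) / 12" for j
    using t0 by simp
  have offset: "real_of_int ((int s - 1) * (int t - 1) div 2) = (real s - 1) * m"
  proof -
    have "2 * real_of_int ((int s - 1) * (int t - 1) div 2) =
        real_of_int (2 * ((int s - 1) * (int t - 1) div 2))"
      by (simp only: of_int_mult of_int_numeral)
    also have "\<dots> = (real s - 1) * (real t - 1)"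
      unfolding two_offset by simp
    finally have "2 * real_of_int ((int s - 1) * (int t - 1) div 2) = (real s - 1) * (real t - 1)" .
    then show ?thesis
      by (simp add: m_def)
  qed
  \<comment> \<open>Centering \<open>s\<close> residues frees \<open>s * m\<close> and the offset
    removes \<open>(s - 1) * m\<close>, so one \<open>m\<close> remains.\<close>
  have center: "real_of_int (word_reps w j) = (\<Sum>i\<in>I. g j (w i)) + m" for w j
    unfolding word_reps_def of_int_diff offset
    by (simp add: g_def sum_subtractf algebra_simps)
  have "(\<Sum>j\<in>T. (real_of_int (word_reps w j))\<^sup>2) =
      (\<Sum>j\<in>T. (\<Sum>i\<in>I. g j (w i))\<^sup>2) + real t * m\<^sup>2" for w
  proof -
    have "(\<Sum>j\<in>T. real_of_int (word_reps w j)) = real t * m"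
    proof -
      have "2 * (\<Sum>j\<in>T. word_reps w j) = int t * (int t - 1)"
        unfolding sum_word_reps by (rule two_choose_two)
      then have "2 * real_of_int (\<Sum>j\<in>T. word_reps w j) = real t * (real t - 1)"
        by (metis of_int_1 of_int_diff of_int_mult of_int_numeral of_int_of_nat_eq)
      then show ?thesis
        by (simp add: m_def)
    qed
    \<comment> \<open>The cross term with \<open>m\<close> therefore vanishes word by word, already
      before averaging.\<close>
    then have "(\<Sum>j\<in>T. \<Sum>i\<in>I. g j (w i)) = 0"
      unfolding center by (simp add: sum.distrib)
    then show ?thesis
      unfolding center power2_sum
      by (simp add: sum.distrib sum_distrib_left[symmetric] sum_distrib_right[symmetric])
  qed
  then have "(\<Sum>w\<in>I \<rightarrow>\<^sub>E T. \<Sum>j\<in>T. (real_of_int (word_reps w j))\<^sup>2) =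
      (\<Sum>j\<in>T. \<Sum>w\<in>I \<rightarrow>\<^sub>E T. (\<Sum>i\<in>I. g j (w i))\<^sup>2) + real t ^ s * (real t * m\<^sup>2)"
    by (simp add: sum.distrib card_PiE sum.swap[of _ "I \<rightarrow>\<^sub>E T" T])
  also have "\<dots> = real t * (real s * real t ^ s * ((real t)\<^sup>2 - 1) / 12) + real t ^ s * (real t * m\<^sup>2)"
    unfolding moment by simp
  also have "\<dots> = real t ^ s *
      (real s * real t * ((real t)\<^sup>2 - 1) / 12 + real t * (real t - 1)\<^sup>2 / 4)"
    by (simp add: m_def power_divide algebra_simps)
  finally show ?thesis .
qed

text \<open>The size is read from the \<open>t\<close>-core encoding, where the representatives are
  the explicit sums \<open>word_reps\<close>.\<close>

lemma psize_word_core: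
  assumes "w \<in> words"
  shows "2 * real t * real (psize (word_core w)) =
    (\<Sum>j\<in>T. (real_of_int (word_reps w j))\<^sup>2) - (\<Sum>j\<in>T. (real_of_int j)\<^sup>2)"
proof -
  have "2 * int t * int (psize (word_core w)) = (\<Sum>j\<in>T. (word_reps w j)\<^sup>2 - j\<^sup>2)"
    using word_core[OF assms]
    by (intro psize_residue_reps[OF t _ residue_reps_word_reps[OF assms]]) (auto simp: cores_def)
  then have "real_of_int (2 * int t * int (psize (word_core w))) =
      real_of_int (\<Sum>j\<in>T. (word_reps w j)\<^sup>2 - j\<^sup>2)"
    by (rule arg_cong)
  then show ?thesis
    by (simp add: sum_subtractf)
qed

lemma sum_psize_word_core:
  "(\<Sum>w\<in>words. real (psize (word_core w))) =
    real (card words) * (1 / 24 * (real s - 1) * ((real t)\<^sup>2 - 1))"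
proof -
  let ?Q = "\<Sum>w\<in>words. \<Sum>j\<in>T. (real_of_int (word_reps w j))\<^sup>2"
  have t0: "real t \<noteq> 0" using t by simp
  have "real t * ?Q = real t * (real (card words) *
      (real s * real t * ((real t)\<^sup>2 - 1) / 12 + real t * (real t - 1)\<^sup>2 / 4))"
    unfolding sum_words_word_reps_square second_moment_word_reps card_words[symmetric]
    by (simp only: mult.assoc)
  then have Q: "?Q = real (card words) *
      (real s * real t * ((real t)\<^sup>2 - 1) / 12 + real t * (real t - 1)\<^sup>2 / 4)"
    using t0 by simp
  have "2 * real t * (\<Sum>w\<in>words. real (psize (word_core w))) =
      (\<Sum>w\<in>words. (\<Sum>j\<in>T. (real_of_int (word_reps w j))\<^sup>2) - (\<Sum>j\<in>T. (real_of_int j)\<^sup>2))"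
    unfolding sum_distrib_left[of "2 * real t"] by (intro sum.cong refl psize_word_core)
  also have "\<dots> = ?Q - real (card words) * (\<Sum>j\<in>T. (real_of_int j)\<^sup>2)"
    by (simp only: sum_subtractf sum_constant)
  \<comment> \<open>After factoring out \<open>t * (t - 1) / 12\<close>, the bracket
    \<open>s * (t + 1) + 3 * (t - 1) - 2 * (2 * t - 1)\<close> is
    \<open>(s - 1) * (t + 1)\<close>.\<close>
  also have "\<dots> = 2 * real t * (real (card words) * (1 / 24 * (real s - 1) * ((real t)\<^sup>2 - 1)))"
    unfolding Q sum_T_square by (simp add: field_simps power2_eq_square)
  finally show ?thesis
    using t0 by (subst (asm) mult_left_cancel) auto
qed

end

theorem theorem1p3:
  fixes s t :: nat
  assumes "s \<ge> 1" and "t \<ge> 1" and "coprime s t"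
  shows "finite (cores s \<inter> cores t)
    \<and> (\<forall>lam \<in> cores s \<inter> cores t. finite (Stab s t lam))
    \<and> (\<Sum>lam \<in> cores s \<inter> cores t. inverse (real (card (Stab s t lam))) * real (psize lam))
      / (\<Sum>lam \<in> cores s \<inter> cores t. inverse (real (card (Stab s t lam))))
      = 1 / 24 * (real s - 1) * ((real t)^2 - 1)"
proof -
  obtain u where "[int s * u = 1] (mod int t)"
    using cong_solve_coprime_int[of "int s" "int t"] assms(3) by auto
  then interpret coprime_pair s t u
    using assms by unfold_locales
  \<comment> \<open>The sum of the weights is \<open>card words / fact s\<close>, so this makes the
    denominator nonzero; the factor \<open>fact s\<close> cancels in the quotient.\<close>
  have "real (card words) \<noteq> 0"
    using card_words t by (metis mult_zero_right not_one_le_zero of_nat_eq_0_iff power_not_zero)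
  then show ?thesis
    using finite_simultaneous_cores card_word_core_fiber(1) sum_psize_word_core
      weighted_sum_cores[of "\<lambda>lam. real (psize lam)"] weighted_sum_cores[of "\<lambda>_. 1"]
    by simp
qed

end
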